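(* Let $q$ be a power of a prime $p$, let $n>1$, let $K=\mathbb{F}_{q^n}$ and $F=K(x)$ the rational function field. Let $E=F(y)$, where $y$ satisfies the equation $$y^{\frac{q^n-1}{q-1}}=\frac{h(x)}{g(x)},$$ where $h(x),g(x)\in F_{qs}^{\phi}$ and $\frac{h(x)}{g(x)}\neq w^{\frac{q^n-1}{q-1}}$ for all $w\in F$. If $h(x)$ and $g(x)$ have no zeros in $\mathbb{F}_{q^n}$, then other than possibly $P_\infty$, all rational places split completely in the extension $E/F$, giving at least $\frac{q^{2n}-q^n}{q-1}$ rational places. In addition, if $r_\infty=[E:F]$, then $P_\infty$ also splits completely in $E$. In that case, all rational places split completely in the extension.
   Context: A rational place is a place of degree one. $P_\infty$ is the unique pole of $x$ in $F$, $v_{P_\infty}$ is its normalized discrete valuation, and $r_\infty=\gcd\left([E:F],v_{P_\infty}(h(x)/g(x))\right)>0$. A rational function $\mathbf{f}(X)\in K(x_1,\dots,x_n)$ is quasi-symmetric if it is fixed by the cyclic permutation $\varepsilon=(1\;2\;\cdots\;n)$ of the variables. An $(n,q)$-quasi-symmetric function is a function of the form $f(x)=\mathbf{f}(x,x^q,\dots,x^{q^{n-1}})$ with $\mathbf{f}$ quasi-symmetric. $F_{qs}^{\phi}$ denotes the field of $(n,q)$-quasi-symmetric rational functions in $F$ whose coefficients are from $\mathbb{F}_q$.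
   Formalization: "No zeros in F_{q^n}" is read as: the underlying quasi-symmetric functions are defined and nonzero at all (a,a^q,...). The place count and the claims on P_∞ (so on all rational places) also assume [E:F]=(q^n-1)/(q-1). Both fail otherwise. *)

theory Defs
  imports
    "HOL-Computational_Algebra.Computational_Algebra"
    "HOL-Library.Poly_Mapping"
    "HOL-Library.Cardinality"
begin

section \<open>Function fields and their places\<close>

text \<open>
  A function field over a constant field of type \<open>'k\<close> is given by a field type \<open>'a\<close> together with
  the embedding \<open>c :: 'k \<Rightarrow> 'a\<close> of the constants. Subfields, valuation rings and places are subsets
  of \<open>'a\<close>.
\<close>

definition is_field_hom :: "('a::field \<Rightarrow> 'b::field) \<Rightarrow> bool" where
  "is_field_hom \<phi> \<longleftrightarrow>
     \<phi> 1 = 1 \<and> (\<forall>x y. \<phi> (x + y) = \<phi> x + \<phi> y) \<and> (\<forall>x y. \<phi> (x * y) = \<phi> x * \<phi> y)"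

definition is_subring :: "'a::field set \<Rightarrow> bool" where
  "is_subring S \<longleftrightarrow> 0 \<in> S \<and> 1 \<in> S \<and> (\<forall>x\<in>S. \<forall>y\<in>S. x - y \<in> S \<and> x * y \<in> S)"

definition is_subfield :: "'a::field set \<Rightarrow> bool" where
  "is_subfield S \<longleftrightarrow> is_subring S \<and> (\<forall>x\<in>S. inverse x \<in> S)"

definition field_adjoin :: "'a::field set \<Rightarrow> 'a \<Rightarrow> 'a set" where
  "field_adjoin S y = \<Inter>{L. is_subfield L \<and> S \<subseteq> L \<and> y \<in> L}"

text \<open>The degree of the extension given by the embedding \<open>\<iota>\<close> (it is 0 if that degree is infinite).\<close>

definition ext_degree :: "('f::field \<Rightarrow> 'e::field) \<Rightarrow> nat" where
  "ext_degree \<iota> = vector_space.dim (\<lambda>a v. \<iota> a * v) (UNIV :: 'e set)"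

definition is_valuation_ring :: "('k::field \<Rightarrow> 'a::field) \<Rightarrow> 'a set \<Rightarrow> bool" where
  "is_valuation_ring c R \<longleftrightarrow>
     is_subring R \<and> range c \<subset> R \<and> R \<subset> UNIV \<and> (\<forall>z. z \<in> R \<or> inverse z \<in> R)"

text \<open>
  A place is the maximal ideal of a valuation ring, that is, its set of non-units. The valuation ring
  is recovered from the place. Since \<open>inverse 0 = 0\<close>, the element 0 needs separate mention.
\<close>

definition is_place :: "('k::field \<Rightarrow> 'a::field) \<Rightarrow> 'a set \<Rightarrow> bool" where
  "is_place c P \<longleftrightarrow>
     (\<exists>R. is_valuation_ring c R \<and> P = {z \<in> R. z = 0 \<or> inverse z \<notin> R})"

definition place_ring :: "'a::field set \<Rightarrow> 'a set" where
  "place_ring P = {z. z = 0 \<or> inverse z \<notin> P}"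

text \<open>
  The residue classes of the elements of \<open>B\<close> are distinct and form a basis of the residue field
  \<open>place_ring P / P\<close> over the constants: every residue class is a unique linear combination of them.
\<close>

definition residue_basis :: "('k::field \<Rightarrow> 'a::field) \<Rightarrow> 'a set \<Rightarrow> 'a set \<Rightarrow> bool" where
  "residue_basis c P B \<longleftrightarrow> finite B \<and> B \<subseteq> place_ring P \<and>
     (\<forall>z \<in> place_ring P. \<exists>!\<gamma> :: 'a \<Rightarrow> 'k.
        (\<forall>b. b \<notin> B \<longrightarrow> \<gamma> b = 0) \<and> z - (\<Sum>b\<in>B. c (\<gamma> b) * b) \<in> P)"

definition has_place_degree :: "('k::field \<Rightarrow> 'a::field) \<Rightarrow> 'a set \<Rightarrow> nat \<Rightarrow> bool" where
  "has_place_degree c P d \<longleftrightarrow> (\<exists>B. residue_basis c P B \<and> card B = d)"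

definition is_rational_place :: "('k::field \<Rightarrow> 'a::field) \<Rightarrow> 'a set \<Rightarrow> bool" where
  "is_rational_place c P \<longleftrightarrow> is_place c P \<and> has_place_degree c P 1"

text \<open>
  Normalized discrete valuation of a nonzero \<open>z\<close>: \<open>z = t\<^sup>k u\<close> with \<open>t\<close> a generator of the ideal \<open>P\<close>
  and \<open>u\<close> a unit of the valuation ring.
\<close>

definition place_val :: "'a::field set \<Rightarrow> 'a \<Rightarrow> int" where
  "place_val P z =
     (THE k. \<exists>t u. P = (\<lambda>a. t * a) ` place_ring P \<and> u \<in> place_ring P - P \<and> z = t powi k * u)"

definition splits_completely ::
    "('k::field \<Rightarrow> 'f::field) \<Rightarrow> ('f \<Rightarrow> 'e::field) \<Rightarrow> 'f set \<Rightarrow> bool" where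
  "splits_completely c \<iota> P \<longleftrightarrow>
     finite {Q. is_place (\<iota> \<circ> c) Q \<and> \<iota> ` P \<subseteq> Q} \<and>
     card {Q. is_place (\<iota> \<circ> c) Q \<and> \<iota> ` P \<subseteq> Q} = ext_degree \<iota>"


section \<open>The rational function field\<close>

type_synonym 'k ratfun = "'k poly fract"

definition rf_const :: "'k::field \<Rightarrow> 'k ratfun" where
  "rf_const a = Fract [:a:] 1"

definition rf_x :: "'k::field ratfun" where
  "rf_x = Fract [:0, 1:] 1"

definition P_inf :: "'k::field ratfun set" where
  "P_inf = (THE P. is_place rf_const P \<and> rf_x \<notin> place_ring P)"


section \<open>Multivariate rational functions\<close>

text \<open>
  Polynomials in \<open>x\<^sub>1, x\<^sub>2, \<dots>\<close>, with the variables numbered from 0. A monomial is the finitely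
  supported function giving the exponent of each variable.
\<close>

type_synonym 'k mpol = "(nat \<Rightarrow>\<^sub>0 nat) \<Rightarrow>\<^sub>0 'k"
type_synonym 'k mrat = "'k mpol fract"

definition in_first_vars :: "nat \<Rightarrow> 'k::zero mpol \<Rightarrow> bool" where
  "in_first_vars n p \<longleftrightarrow> (\<forall>m \<in> Poly_Mapping.keys p. Poly_Mapping.keys m \<subseteq> {..<n})"

definition mpol_eval :: "('k::zero \<Rightarrow> 'b::comm_semiring_1) \<Rightarrow> (nat \<Rightarrow> 'b) \<Rightarrow> 'k mpol \<Rightarrow> 'b" where
  "mpol_eval \<phi> b p =
     (\<Sum>m\<in>Poly_Mapping.keys p.
        \<phi> (Poly_Mapping.lookup p m) * (\<Prod>i\<in>Poly_Mapping.keys m. b i ^ Poly_Mapping.lookup m i))"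

definition mrat_rep :: "nat \<Rightarrow> 'k::field mrat \<Rightarrow> 'k mpol \<Rightarrow> 'k mpol \<Rightarrow> bool" where
  "mrat_rep n f N D \<longleftrightarrow> in_first_vars n N \<and> in_first_vars n D \<and> D \<noteq> 0 \<and> f = Fract N D"

text \<open>The field \<open>K(x\<^sub>1,\<dots>,x\<^sub>n)\<close>.\<close>

definition mrat_field :: "nat \<Rightarrow> 'k::field mrat set" where
  "mrat_field n = {f. \<exists>N D. mrat_rep n f N D}"

text \<open>
  Evaluation of a rational function at a point \<open>b\<close> with coordinates in an extension field of the
  coefficient field. It makes sense if some representation has a denominator not vanishing there.
\<close>

definition mrat_defined ::
    "nat \<Rightarrow> ('k::field \<Rightarrow> 'b::field) \<Rightarrow> (nat \<Rightarrow> 'b) \<Rightarrow> 'k mrat \<Rightarrow> bool" where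
  "mrat_defined n \<phi> b f \<longleftrightarrow> (\<exists>N D. mrat_rep n f N D \<and> mpol_eval \<phi> b D \<noteq> 0)"

definition mrat_eval ::
    "nat \<Rightarrow> ('k::field \<Rightarrow> 'b::field) \<Rightarrow> (nat \<Rightarrow> 'b) \<Rightarrow> 'k mrat \<Rightarrow> 'b" where
  "mrat_eval n \<phi> b f =
     (THE v. \<exists>N D. mrat_rep n f N D \<and> mpol_eval \<phi> b D \<noteq> 0 \<and>
                   v = mpol_eval \<phi> b N / mpol_eval \<phi> b D)"

definition mrat_const :: "'k::field \<Rightarrow> 'k mrat" where
  "mrat_const a = Fract (Poly_Mapping.single 0 a) 1"

definition mrat_var :: "nat \<Rightarrow> 'k::field mrat" where
  "mrat_var i = Fract (Poly_Mapping.single (Poly_Mapping.single i 1) 1) 1"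


section \<open>Quasi-symmetric functions\<close>

text \<open>Substituting \<open>x\<^sub>\<epsilon>\<^sub>(\<^sub>i\<^sub>)\<close> for \<open>x\<^sub>i\<close>, where \<open>\<epsilon>\<close> is the \<open>n\<close>-cycle, fixes the function.\<close>

definition quasi_symmetric :: "nat \<Rightarrow> 'k::field mrat \<Rightarrow> bool" where
  "quasi_symmetric n f \<longleftrightarrow>
     f \<in> mrat_field n \<and> mrat_eval n mrat_const (\<lambda>i. mrat_var (Suc i mod n)) f = f"

text \<open>\<open>w\<close> is the function \<open>f(x, x\<^sup>q, \<dots>)\<close>, with \<open>n\<close> arguments, in the rational function field.\<close>

definition qs_represents :: "nat \<Rightarrow> nat \<Rightarrow> 'k::field mrat \<Rightarrow> 'k ratfun \<Rightarrow> bool" where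
  "qs_represents n q f w \<longleftrightarrow>
     quasi_symmetric n f \<and>
     mrat_defined n rf_const (\<lambda>i. rf_x ^ (q ^ i)) f \<and>
     w = mrat_eval n rf_const (\<lambda>i. rf_x ^ (q ^ i)) f"

text \<open>The subfield of order \<open>q\<close> of a finite field of order \<open>q\<^sup>n\<close>.\<close>

definition Fq :: "nat \<Rightarrow> 'k::field set" where
  "Fq q = {a. a ^ q = a}"

definition F_qs_phi :: "nat \<Rightarrow> nat \<Rightarrow> 'k::field ratfun set" where
  "F_qs_phi n q =
     {w. (\<exists>f. qs_represents n q f w) \<and>
         (\<exists>A B. B \<noteq> 0 \<and> w = Fract A B \<and> (\<forall>i. coeff A i \<in> Fq q) \<and> (\<forall>i. coeff B i \<in> Fq q))}"

text \<open>
  The value of an \<open>(n,q)\<close>-quasi-symmetric function at a constant \<open>a\<close> is that of the underlying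
  multivariate function at the point \<open>(a, a\<^sup>q, \<dots>)\<close>. Having no zeros among the constants means
  being a function on the constants, defined and nonzero everywhere.

  Requiring this only of the element \<open>w\<close> of the one-variable field would not do: cancellation
  between \<open>f(x, x\<^sup>q, \<dots>)\<close>'s numerator and denominator hides points where \<open>f\<close> is undefined. For
  \<open>q = n = 2\<close> the function \<open>f = (x\<^sub>1 x\<^sub>2 + x\<^sub>1 + x\<^sub>2) / (x\<^sub>1 + x\<^sub>2 + 1)\<close> is symmetric, and
  \<open>f(x, x\<^sup>2) = x\<close> does not take values in the field of order 2.
\<close>

definition qs_no_zeros :: "nat \<Rightarrow> nat \<Rightarrow> 'k::field ratfun \<Rightarrow> bool" where
  "qs_no_zeros n q w \<longleftrightarrow>
     (\<exists>f. qs_represents n q f w \<and>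
        (\<forall>a. mrat_defined n (\<lambda>c. c) (\<lambda>i. a ^ (q ^ i)) f \<and>
             mrat_eval n (\<lambda>c. c) (\<lambda>i. a ^ (q ^ i)) f \<noteq> 0))"

end

theory Submission
  imports Defs
begin

text \<open>
  Let \<open>P\<close> be a rational place of \<open>F = K(x)\<close>. Expansion at \<open>P\<close> embeds \<open>F\<close> into the Laurent series
  \<open>K((t))\<close>. Quasi-symmetry and coefficients in \<open>\<bbbF>\<^sub>q\<close> force the residue of \<open>u = h/g\<close> at \<open>a \<in> K\<close> to lie
  in \<open>\<bbbF>\<^sub>q\<^sup>*\<close>, hence to be an \<open>m\<close>-th power (a norm) in \<open>K\<close>; by Hensel's lemma \<open>u\<close> then has all its
  \<open>m\<close>-th roots in \<open>K((t))\<close>. So the minimal polynomial of \<open>y\<close>, a factor of \<open>X\<^sup>m - u\<close>, has \<open>[E:F]\<close>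
  distinct roots in \<open>K((t))\<close>, and each root gives an embedding of \<open>E\<close> into \<open>K((t))\<close>, that is, a
  rational place above \<open>P\<close>. There are no others: as \<open>F\<close> is dense in \<open>K((t))\<close>, a place above \<open>P\<close> is determined
  by the residue of \<open>y\<close>. At the pole of \<open>x\<close> the same argument applies to \<open>y / t\<^sup>k\<close>, where
  \<open>v(u) = m k\<close>; the residue is now a quotient of leading coefficients.
\<close>

text \<open>The obstacle at a point \<open>a\<close> is that the two conditions on \<open>h\<close>
  and \<open>g\<close> concern different representations: quasi-symmetry is about a multivariate
  \<open>f\<close>, coefficients in the field of order \<open>q\<close> are about a univariate
  fraction \<open>A / B\<close>, and \<open>A\<close> and \<open>B\<close> may both vanish at
  \<open>a\<close>. They meet in K((t)): at the transcendental points \<open>a + t\<close> and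
  \<open>(a + t)^q\<close> no denominator vanishes, and the residue is taken only afterwards. What
  links the two points is that the q-th power map shifts \<open>(a, a^q, ...)\<close> cyclically,
  because \<open>a^(q^n) = a\<close>. The identity \<open>m (q - 1) = q^n - 1\<close> makes every
  nonzero element of the field of order \<open>q\<close> an m-th power in K and, read modulo
  \<open>p\<close>, gives \<open>m = 1\<close> in K, so that Hensel's lemma applies. A place of E is
  just a set of non-units; nothing is known beforehand about discreteness or about the number of
  places above \<open>P\<close>. In place of ramification theory, elements of E are approximated by
  elements of F simultaneously at the given place and in K((t)), which matches their orders.\<close>

lemma is_field_hom_compose: "is_field_hom f \<Longrightarrow> is_field_hom g \<Longrightarrow> is_field_hom (f \<circ> g)"
  by (simp add: is_field_hom_def)

lemma is_field_hom_fls_const: "is_field_hom (fls_const :: 'k::field \<Rightarrow> _)"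
  by (simp add: is_field_hom_def fls_plus_const)

section \<open>Field embeddings and evaluation of polynomials along them\<close>

locale field_embedding =
  fixes \<phi> :: "'a::field \<Rightarrow> 'b::field"
  assumes field_hom: "is_field_hom \<phi>"
begin

lemma hom_1 [simp]: "\<phi> 1 = 1"
  and hom_add: "\<phi> (x + y) = \<phi> x + \<phi> y"
  and hom_mult: "\<phi> (x * y) = \<phi> x * \<phi> y"
  using field_hom by (auto simp: is_field_hom_def)

lemma hom_0 [simp]: "\<phi> 0 = 0"
  by (metis add_cancel_right_right hom_add)

lemma hom_minus: "\<phi> (- x) = - \<phi> x"
  using hom_add[of x "- x"] by (simp add: eq_neg_iff_add_eq_0 add.commute)

lemma hom_diff: "\<phi> (x - y) = \<phi> x - \<phi> y"
  using hom_add[of x "- y"] by (simp add: hom_minus)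

lemma hom_power: "\<phi> (x ^ n) = \<phi> x ^ n"
  by (induction n) (simp_all add: hom_mult)

lemma hom_eq_0_iff [simp]: "\<phi> x = 0 \<longleftrightarrow> x = 0"
proof
  assume "\<phi> x = 0"
  show "x = 0"
  proof (rule ccontr)
    assume "x \<noteq> 0"
    hence "\<phi> x * \<phi> (inverse x) = 1"
      by (simp flip: hom_mult)
    with \<open>\<phi> x = 0\<close> show False
      by simp
  qed
qed simp

lemma hom_eq_iff [simp]: "\<phi> x = \<phi> y \<longleftrightarrow> x = y"
  using hom_eq_0_iff[of "x - y"] by (simp add: hom_diff)

lemma hom_inverse: "\<phi> (inverse x) = inverse (\<phi> x)"
proof (cases "x = 0")
  case False
  hence "\<phi> x * \<phi> (inverse x) = 1"
    by (simp flip: hom_mult)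
  thus ?thesis
    by (metis inverse_unique)
qed simp

lemma hom_divide: "\<phi> (x / y) = \<phi> x / \<phi> y"
  by (simp add: divide_inverse hom_mult hom_inverse)

lemma hom_power_int: "\<phi> (x powi k) = \<phi> x powi k"
  by (simp add: power_int_def hom_power hom_inverse)

lemma hom_sum: "\<phi> (sum f A) = (\<Sum>x\<in>A. \<phi> (f x))"
  by (induction A rule: infinite_finite_induct) (simp_all add: hom_add)

definition heval :: "'b \<Rightarrow> 'a poly \<Rightarrow> 'b" where
  "heval \<xi> p = poly (map_poly \<phi> p) \<xi>"

lemma degree_map_hom [simp]: "degree (map_poly \<phi> p) = degree p"
  by (rule degree_map_poly) simp

lemma map_hom_eq_0_iff [simp]: "map_poly \<phi> p = 0 \<longleftrightarrow> p = 0"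
  by (rule map_poly_eq_0_iff) auto

lemma map_hom_add: "map_poly \<phi> (p + q) = map_poly \<phi> p + map_poly \<phi> q"
  by (rule poly_eqI) (simp add: coeff_map_poly hom_add)

lemma map_hom_diff: "map_poly \<phi> (p - q) = map_poly \<phi> p - map_poly \<phi> q"
  by (rule poly_eqI) (simp add: coeff_map_poly hom_diff)

lemma map_hom_mult: "map_poly \<phi> (p * q) = map_poly \<phi> p * map_poly \<phi> q"
  by (rule poly_eqI) (simp add: coeff_map_poly coeff_mult hom_sum hom_mult)

lemma heval_pCons [simp]: "heval \<xi> (pCons a p) = \<phi> a + \<xi> * heval \<xi> p"
  by (simp add: heval_def map_poly_pCons)

lemma heval_0 [simp]: "heval \<xi> 0 = 0"
  and heval_1 [simp]: "heval \<xi> 1 = 1"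
  by (simp_all add: heval_def map_poly_1')

lemma heval_add: "heval \<xi> (p + q) = heval \<xi> p + heval \<xi> q"
  and heval_diff: "heval \<xi> (p - q) = heval \<xi> p - heval \<xi> q"
  and heval_mult: "heval \<xi> (p * q) = heval \<xi> p * heval \<xi> q"
  by (simp_all add: heval_def map_hom_add map_hom_diff map_hom_mult)

lemma heval_sum: "heval \<xi> (sum f A) = (\<Sum>i\<in>A. heval \<xi> (f i))"
  by (induction A rule: infinite_finite_induct) (simp_all add: heval_add)

lemma heval_prod: "heval \<xi> (prod f A) = (\<Prod>i\<in>A. heval \<xi> (f i))"
  by (induction A rule: infinite_finite_induct) (simp_all add: heval_mult)

lemma heval_monom: "heval \<xi> (monom a n) = \<phi> a * \<xi> ^ n"
  by (induction n) (simp_all add: monom_0 monom_Suc)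

lemma heval_altdef: "heval \<xi> p = (\<Sum>i\<le>degree p. \<phi> (coeff p i) * \<xi> ^ i)"
  by (simp add: heval_def poly_altdef coeff_map_poly)

lemma heval_pcompose: "heval \<xi> (pcompose p r) = heval (heval \<xi> r) p"
  by (induction p) (simp_all add: pcompose_pCons heval_add heval_mult)

end

section \<open>Laurent series\<close>

unbundle fps_syntax

definition fls_ring :: "'k::field fls set" where
  "fls_ring = {v. fls_subdegree v \<ge> 0}"

definition fls_ideal :: "'k::field fls set" where
  "fls_ideal = {v. v = 0 \<or> fls_subdegree v > 0}"

lemma fls_ring_iff: "v \<in> fls_ring \<longleftrightarrow> v \<in> range fps_to_fls"
proof
  assume "v \<in> fls_ring"
  hence "fps_to_fls (fls_regpart v) = v"
    by (simp add: fls_ring_def)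
  thus "v \<in> range fps_to_fls"
    by (metis rangeI)
qed (auto simp: fls_ring_def fls_subdegree_fls_to_fps_gt0)

lemma fps_to_fls_in_ring [simp]: "fps_to_fls f \<in> fls_ring"
  by (simp add: fls_ring_iff)

lemma fls_const_in_ring [simp]: "fls_const a \<in> fls_ring"
  by (simp add: fls_ring_def)

lemma fls_ring_0 [simp]: "0 \<in> fls_ring"
  and fls_ring_1 [simp]: "1 \<in> fls_ring"
  by (simp_all add: fls_ring_def)

lemma fls_ring_closed:
  assumes "v \<in> fls_ring" "w \<in> fls_ring"
  shows "v + w \<in> fls_ring" "v - w \<in> fls_ring" "v * w \<in> fls_ring"
proof -
  obtain f g where "v = fps_to_fls f" "w = fps_to_fls g"
    using assms by (auto simp: fls_ring_iff)
  thus "v + w \<in> fls_ring" "v - w \<in> fls_ring" "v * w \<in> fls_ring"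
    by (auto simp flip: fps_to_fls_plus fps_to_fls_minus fls_times_fps_to_fls)
qed

lemma fls_ring_power: "v \<in> fls_ring \<Longrightarrow> v ^ n \<in> fls_ring"
  by (induction n) (simp_all add: fls_ring_closed)

lemma fls_ring_sum: "(\<And>i. i \<in> A \<Longrightarrow> f i \<in> fls_ring) \<Longrightarrow> sum f A \<in> fls_ring"
  by (induction A rule: infinite_finite_induct) (auto intro: fls_ring_closed)

lemma fls_residue_mult:
  assumes "v \<in> fls_ring" "w \<in> fls_ring"
  shows "(v * w) $$ 0 = v $$ 0 * w $$ 0"
proof -
  obtain f g where "v = fps_to_fls f" "w = fps_to_fls g"
    using assms by (auto simp: fls_ring_iff)
  thus ?thesis
    by (simp flip: fls_times_fps_to_fls)
qed

lemma fls_residue_power: "v \<in> fls_ring \<Longrightarrow> (v ^ n) $$ 0 = (v $$ 0) ^ n"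
  by (induction n) (simp_all add: fls_residue_mult fls_ring_power)

lemma fls_ideal_iff: "v \<in> fls_ideal \<longleftrightarrow> v \<in> fls_ring \<and> v $$ 0 = 0"
proof
  assume "v \<in> fls_ring \<and> v $$ 0 = 0"
  hence "fls_subdegree v \<noteq> 0 \<or> v = 0"
    using nth_fls_subdegree_nonzero by fastforce
  thus "v \<in> fls_ideal"
    using \<open>v \<in> fls_ring \<and> v $$ 0 = 0\<close> by (auto simp: fls_ideal_def fls_ring_def)
qed (auto simp: fls_ideal_def fls_ring_def)

lemma fls_ideal_iff_inverse: "v \<in> fls_ideal \<longleftrightarrow> v \<in> fls_ring \<and> (v = 0 \<or> inverse v \<notin> fls_ring)"
  by (auto simp: fls_ideal_def fls_ring_def)

lemma fls_X_in_ideal: "fls_X \<in> fls_ideal"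
  by (simp add: fls_ideal_def)

lemma fls_divide_in_ring_iff:
  "w \<noteq> 0 \<Longrightarrow> v / w \<in> fls_ring \<longleftrightarrow> v = 0 \<or> fls_subdegree w \<le> fls_subdegree v"
  by (cases "v = 0") (auto simp: fls_ring_def fls_divide_subdegree)

definition fls_place :: "('a::field \<Rightarrow> 'k::field fls) \<Rightarrow> 'a set" where
  "fls_place \<rho> = {z. \<rho> z \<in> fls_ideal}"

text \<open>A place with residue field \<open>'k\<close>, given by an embedding into the Laurent series.\<close>

locale series_embedding = field_embedding \<rho> for \<rho> :: "'a::field \<Rightarrow> 'k::field fls" +
  fixes c :: "'k \<Rightarrow> 'a" and \<tau> :: 'a
  assumes const [simp]: "\<rho> (c a) = fls_const a"
  and param [simp]: "\<rho> \<tau> = fls_X"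
begin

lemma param_nonzero: "\<tau> \<noteq> 0"
  using param hom_0 by (metis fls_X_nonzero)

lemma is_valuation_ring_fls: "is_valuation_ring c {z. \<rho> z \<in> fls_ring}"
  unfolding is_valuation_ring_def
proof (intro conjI allI)
  show "is_subring {z. \<rho> z \<in> fls_ring}"
    by (auto simp: is_subring_def hom_mult hom_diff intro: fls_ring_closed)
  have "inverse \<tau> \<notin> {z. \<rho> z \<in> fls_ring}"
    by (simp add: hom_inverse fls_ring_def)
  thus "{z. \<rho> z \<in> fls_ring} \<subset> UNIV"
    by blast
  have "\<tau> \<in> {z. \<rho> z \<in> fls_ring}"
    by (simp add: fls_ring_def)
  moreover have "\<tau> \<notin> range c"
  proof
    assume "\<tau> \<in> range c"
    then obtain a where "\<tau> = c a"
      by auto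
    hence "fls_X = fls_const a"
      by (metis const param)
    thus False
      by (metis fls_X_subdegree fls_const_subdegree zero_neq_one)
  qed
  ultimately show "range c \<subset> {z. \<rho> z \<in> fls_ring}"
    by auto
  fix z show "z \<in> {z. \<rho> z \<in> fls_ring} \<or> inverse z \<in> {z. \<rho> z \<in> fls_ring}"
    by (auto simp: hom_inverse fls_ring_def)
qed

lemma fls_place_altdef:
  "fls_place \<rho> = {z \<in> {z. \<rho> z \<in> fls_ring}. z = 0 \<or> inverse z \<notin> {z. \<rho> z \<in> fls_ring}}"
  by (auto simp: fls_place_def fls_ideal_iff_inverse hom_inverse)

lemma is_place_fls: "is_place c (fls_place \<rho>)"
  unfolding is_place_def using is_valuation_ring_fls fls_place_altdef by blast

lemma place_ring_fls: "place_ring (fls_place \<rho>) = {z. \<rho> z \<in> fls_ring}"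
  by (auto simp: place_ring_def fls_place_def hom_inverse fls_ideal_def fls_ring_def)

text \<open>Modulo the place, \<open>z\<close> is congruent to the constant coefficient of
  \<open>\<rho> z\<close>, which comes from a constant; so \<open>1\<close> alone is a basis of the
  residue field.\<close>

lemma is_rational_place_fls: "is_rational_place c (fls_place \<rho>)"
proof -
  have "residue_basis c (fls_place \<rho>) {1}"
    unfolding residue_basis_def place_ring_fls
  proof (intro conjI ballI)
    fix z assume "z \<in> {z. \<rho> z \<in> fls_ring}"
    hence z: "\<rho> z \<in> fls_ring"
      by simp
    show "\<exists>!\<gamma>. (\<forall>b. b \<notin> {1} \<longrightarrow> \<gamma> b = 0) \<and> z - (\<Sum>b\<in>{1}. c (\<gamma> b) * b) \<in> fls_place \<rho>"
    proof (rule ex1I[of _ "\<lambda>b. if b = 1 then \<rho> z $$ 0 else 0"])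
      show "(\<forall>b. b \<notin> {1} \<longrightarrow> (if b = 1 then \<rho> z $$ 0 else 0) = 0) \<and>
         z - (\<Sum>b\<in>{1}. c (if b = 1 then \<rho> z $$ 0 else 0) * b) \<in> fls_place \<rho>"
        using z by (simp add: fls_place_def hom_diff fls_ideal_iff fls_ring_closed)
      fix \<gamma> assume *: "(\<forall>b. b \<notin> {1} \<longrightarrow> \<gamma> b = 0) \<and> z - (\<Sum>b\<in>{1}. c (\<gamma> b) * b) \<in> fls_place \<rho>"
      hence "\<rho> (z - c (\<gamma> 1)) \<in> fls_ideal"
        by (simp add: fls_place_def)
      hence "\<gamma> 1 = \<rho> z $$ 0"
        by (simp add: fls_ideal_iff hom_diff)
      with * show "\<gamma> = (\<lambda>b. if b = 1 then \<rho> z $$ 0 else 0)"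
        by auto
    qed
  qed (auto)
  thus ?thesis
    using is_place_fls by (auto simp: is_rational_place_def has_place_degree_def intro!: exI[of _ "{1}"])
qed

end

section \<open>Roots of power series\<close>

lemma fps_mult_nth_eq_0:
  fixes f g :: "'k::comm_ring_1 fps"
  assumes "\<And>i. i \<le> n \<Longrightarrow> f $ i = 0"
  shows "(f * g) $ n = 0"
  using assms by (simp add: fps_mult_nth)

text \<open>As \<open>f - g\<close> divides \<open>f ^ m - g ^ m\<close>, agreement up to order
  \<open>n\<close> survives taking powers. This is the continuity needed to pass to the limit in
  Hensel's lemma.\<close>

lemma fps_nth_power_cong:
  fixes f g :: "'k::comm_ring_1 fps"
  assumes "\<And>i. i \<le> n \<Longrightarrow> f $ i = g $ i"
  shows "(f ^ m) $ n = (g ^ m) $ n"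
proof -
  have "(f ^ m - g ^ m) $ n = 0"
    using assms by (subst power_diff_sumr2) (auto intro!: fps_mult_nth_eq_0)
  thus ?thesis
    by simp
qed

text \<open>Hensel's lemma for \<open>X\<^sup>m - v\<close>, by determining one coefficient after the other.\<close>

lemma fps_nth_root_exists:
  fixes v :: "'k::field fps"
  assumes b: "b ^ m = v $ 0" "b \<noteq> 0" and m: "of_nat m \<noteq> (0::'k)"
  obtains r where "r ^ m = v" "r $ 0 = b"
proof -
  have "\<exists>f. \<forall>n. (f n $ 0 = b \<and> (\<forall>i\<le>n. (f n ^ m) $ i = v $ i)) \<and> (\<forall>i\<le>n. f (Suc n) $ i = f n $ i)"
  proof (rule dependent_nat_choice)
    show "\<exists>r. r $ 0 = b \<and> (\<forall>i\<le>0. (r ^ m) $ i = v $ i)"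
      by (intro exI[of _ "fps_const b"]) (simp add: b)
    fix r n assume r: "r $ 0 = b \<and> (\<forall>i\<le>n. (r ^ m) $ i = v $ i)"
    \<comment> \<open>Newton correction: adding \<open>e X^(n+1)\<close> to \<open>r\<close> leaves
      the coefficients of \<open>r ^ m\<close> up to \<open>n\<close> alone and changes the next one
      by \<open>m b^(m-1) e\<close>.\<close>
    define e where "e = (v $ Suc n - (r ^ m) $ Suc n) / (of_nat m * b ^ (m - 1))"
    define s where "s = r + fps_X ^ Suc n * fps_const e"
    \<comment> \<open>The cofactor of \<open>s - r\<close> in \<open>s ^ m - r ^ m\<close>; only its
      constant coefficient influences the coefficient being corrected.\<close>
    define S where "S = (\<Sum>i<m. r ^ (m - Suc i) * s ^ i)"
    have s0: "s $ 0 = b"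
      using r by (simp add: s_def)
    have "S $ 0 = (\<Sum>i<m. b ^ (m - Suc i) * b ^ i)"
      using r s0 by (simp add: S_def fps_sum_nth fps_nth_power_0)
    also have "\<dots> = (\<Sum>i<m. b ^ (m - 1))"
      by (intro sum.cong) (auto simp flip: power_add)
    finally have S0: "S $ 0 = of_nat m * b ^ (m - 1)"
      by simp
    have diff: "s ^ m - r ^ m = fps_X ^ Suc n * (fps_const e * S)"
      by (subst power_diff_sumr2) (simp add: s_def S_def mult_ac)
    have "(s ^ m) $ i = v $ i" if "i \<le> Suc n" for i
    proof (cases "i = Suc n")
      case True
      have "(s ^ m - r ^ m) $ i = e * S $ 0"
        unfolding diff fps_X_power_mult_nth using True by simp
      also have "\<dots> = v $ i - (r ^ m) $ i"
        using b m True by (simp add: S0 e_def)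
      finally show ?thesis
        by simp
    next
      case False
      hence "(s ^ m - r ^ m) $ i = 0"
        unfolding diff fps_X_power_mult_nth using that by simp
      thus ?thesis
        using r that False by simp
    qed
    moreover have "s $ i = r $ i" if "i \<le> n" for i
      using that by (simp only: s_def fps_add_nth fps_X_power_mult_nth) simp
    ultimately show "\<exists>s. (s $ 0 = b \<and> (\<forall>i\<le>Suc n. (s ^ m) $ i = v $ i)) \<and> (\<forall>i\<le>n. s $ i = r $ i)"
      using s0 by blast
  qed
  then obtain f where f0: "\<And>n. f n $ 0 = b"
    and fm: "\<And>n i. i \<le> n \<Longrightarrow> (f n ^ m) $ i = v $ i"
    and fS: "\<And>n i. i \<le> n \<Longrightarrow> f (Suc n) $ i = f n $ i"
    by blast
  have f_eq: "f (i + k) $ i = f i $ i" for i k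
    by (induction k) (simp_all add: fS)
  \<comment> \<open>The diagonal agrees with \<open>f n\<close> up to order \<open>n\<close>, since
    later corrections never touch coefficients already fixed.\<close>
  define r where "r = Abs_fps (\<lambda>n. f n $ n)"
  have "(r ^ m) $ n = v $ n" for n
  proof -
    have "r $ i = f n $ i" if "i \<le> n" for i
      using f_eq[of i "n - i"] that by (simp add: r_def)
    hence "(r ^ m) $ n = (f n ^ m) $ n"
      by (rule fps_nth_power_cong)
    thus ?thesis
      by (simp add: fm)
  qed
  hence "r ^ m = v"
    by (simp add: fps_eq_iff)
  moreover have "r $ 0 = b"
    by (simp add: r_def f0)
  ultimately show ?thesis
    using that by blast
qed

section \<open>Arithmetic of a place and its valuation ring\<close>

locale function_place =
  fixes c :: "'k::field \<Rightarrow> 'a::field" and P :: "'a set"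
  assumes is_place: "is_place c P"
begin

text \<open>If \<open>inverse z\<close> is not a non-unit of \<open>R\<close>, it is either a unit
  of \<open>R\<close> or outside \<open>R\<close>; in both cases \<open>z\<close> belongs to
  \<open>R\<close>. So \<open>place_ring\<close> gives back the ring that the definition of a place
  hides behind a quantifier.\<close>

lemma valuation_ring: "is_valuation_ring c (place_ring P)"
  and place_eq: "P = {z \<in> place_ring P. z = 0 \<or> inverse z \<notin> place_ring P}"
proof -
  obtain R where R: "is_valuation_ring c R" "P = {z \<in> R. z = 0 \<or> inverse z \<notin> R}"
    using is_place by (auto simp: is_place_def)
  have [simp]: "0 \<in> R" and *: "z \<in> R \<or> inverse z \<in> R" for z
    using R(1) by (auto simp: is_valuation_ring_def is_subring_def)
  have "place_ring P = R"
    using * by (auto simp: place_ring_def R(2))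
  with R show "is_valuation_ring c (place_ring P)"
    "P = {z \<in> place_ring P. z = 0 \<or> inverse z \<notin> place_ring P}"
    by simp_all
qed

lemma ring_0 [simp]: "0 \<in> place_ring P"
  and ring_1 [simp]: "1 \<in> place_ring P"
  and ring_const [simp]: "c a \<in> place_ring P"
  and ring_diff: "z \<in> place_ring P \<Longrightarrow> w \<in> place_ring P \<Longrightarrow> z - w \<in> place_ring P"
  and ring_mult: "z \<in> place_ring P \<Longrightarrow> w \<in> place_ring P \<Longrightarrow> z * w \<in> place_ring P"
  and ring_or_inverse: "z \<in> place_ring P \<or> inverse z \<in> place_ring P"
  using valuation_ring unfolding is_valuation_ring_def is_subring_def by blast+

lemma ring_add: "z \<in> place_ring P \<Longrightarrow> w \<in> place_ring P \<Longrightarrow> z + w \<in> place_ring P"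
  using ring_diff[of z "0 - w"] ring_diff[of 0 w] by simp

lemma ring_power: "z \<in> place_ring P \<Longrightarrow> z ^ n \<in> place_ring P"
  by (induction n) (auto intro: ring_mult)

lemma place_in_ring: "z \<in> P \<Longrightarrow> z \<in> place_ring P"
  using place_eq by blast

lemma place_iff: "z \<in> P \<longleftrightarrow> z \<in> place_ring P \<and> (z = 0 \<or> inverse z \<notin> place_ring P)"
  using place_eq by blast

lemma place_0 [simp]: "0 \<in> P"
  and place_1 [simp]: "1 \<notin> P"
  by (simp_all add: place_iff)

lemma ring_iff: "z \<in> place_ring P \<longleftrightarrow> z = 0 \<or> inverse z \<notin> P"
  by (simp add: place_ring_def)

lemma place_mult:
  assumes "z \<in> P" "w \<in> place_ring P"
  shows "z * w \<in> P"
proof (cases "z * w = 0")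
  case False
  have "z * w \<in> place_ring P"
    using assms by (simp add: ring_mult place_in_ring)
  moreover have "inverse (z * w) \<notin> place_ring P"
  proof
    assume "inverse (z * w) \<in> place_ring P"
    hence "inverse (z * w) * w \<in> place_ring P"
      using assms by (simp add: ring_mult)
    also have "inverse (z * w) * w = inverse z"
      using False by simp
    finally show False
      using assms False by (simp add: place_iff)
  qed
  ultimately show ?thesis
    by (simp add: place_iff)
qed auto

lemma place_mult': "w \<in> place_ring P \<Longrightarrow> z \<in> P \<Longrightarrow> w * z \<in> P"
  by (subst mult.commute) (rule place_mult)

text \<open>One of \<open>z / w\<close> and \<open>w / z\<close> lies in the ring, so the difference
  is a ring multiple of \<open>w\<close> or of \<open>z\<close>.\<close>

lemma place_diff:
  assumes "z \<in> P" "w \<in> P"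
  shows "z - w \<in> P"
proof (cases "z = 0 \<or> w = 0")
  case True
  have "0 - 1 \<in> place_ring P"
    by (intro ring_diff) auto
  from place_mult[OF \<open>w \<in> P\<close> this] show ?thesis
    using True assms by auto
next
  case False
  have "inverse (z / w) = w / z"
    by simp
  hence "z / w \<in> place_ring P \<or> w / z \<in> place_ring P"
    using ring_or_inverse[of "z / w"] by (simp del: inverse_divide)
  hence "w * (z / w - 1) \<in> P \<or> z * (1 - w / z) \<in> P"
    using assms by (auto intro!: place_mult ring_diff)
  thus ?thesis
    using False by (simp add: algebra_simps)
qed

lemma place_add: "z \<in> P \<Longrightarrow> w \<in> P \<Longrightarrow> z + w \<in> P"
  using place_diff[of z "0 - w"] place_diff[of 0 w] by simp

lemma unit_inverse: "z \<in> place_ring P \<Longrightarrow> z \<notin> P \<Longrightarrow> inverse z \<in> place_ring P"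
  by (simp add: place_iff)

lemma unit_inverse_not_place: "z \<in> place_ring P \<Longrightarrow> z \<notin> P \<Longrightarrow> inverse z \<notin> P"
  by (auto simp: place_iff)

lemma place_prime:
  assumes "z * w \<in> P" "z \<in> place_ring P" "w \<in> place_ring P"
  shows "z \<in> P \<or> w \<in> P"
proof (rule ccontr)
  assume "\<not> ?thesis"
  hence "inverse z * inverse w \<in> place_ring P" "z \<noteq> 0" "w \<noteq> 0"
    using assms by (auto intro!: ring_mult unit_inverse)
  thus False
    using assms by (simp add: place_iff mult.commute)
qed

lemma place_prime_prod:
  assumes "finite A" "(\<Prod>i\<in>A. f i) \<in> P" "\<And>i. i \<in> A \<Longrightarrow> f i \<in> place_ring P"
  shows "\<exists>i\<in>A. f i \<in> P"
  using assms
proof (induction A rule: finite_induct)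
  case (insert i A)
  have "(\<Prod>j\<in>A. f j) \<in> place_ring P"
    using insert.prems(2) by (induction A rule: infinite_finite_induct) (auto intro: ring_mult)
  with insert show ?case
    using place_prime[of "f i" "\<Prod>j\<in>A. f j"] by auto
qed simp

lemma place_power: "z \<in> P \<Longrightarrow> n > 0 \<Longrightarrow> z ^ n \<in> P"
  by (cases n) (auto intro: place_mult ring_power place_in_ring)

lemma unit_add:
  assumes "u \<in> place_ring P" "u \<notin> P" "z \<in> P"
  shows "u + z \<notin> P"
  using assms place_diff[of "u + z" z] by auto

text \<open>Membership depends on the exponent alone. Two places can therefore be compared by
  writing all elements as powers of a common \<open>t\<close> times units.\<close>

lemma powi_mult_unit_in_place_iff:
  assumes "t \<in> P" "t \<noteq> 0" "w \<in> place_ring P" "w \<notin> P"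
  shows "t powi k * w \<in> P \<longleftrightarrow> k > 0"
proof (cases "k > 0")
  case True
  hence "t powi k \<in> P"
    using assms by (simp add: power_int_def place_power)
  thus ?thesis
    using True assms by (simp add: place_mult)
next
  case False
  hence "inverse (t powi k) \<in> place_ring P"
    using assms by (auto simp: power_int_def ring_power place_in_ring power_inverse)
  hence "inverse (t powi k * w) \<in> place_ring P"
    using assms by (auto intro!: ring_mult unit_inverse)
  moreover have "t powi k * w \<noteq> 0"
    using assms by (auto simp: power_int_eq_0_iff)
  ultimately show ?thesis
    using False place_iff by blast
qed

lemma const_in_place_iff:
  assumes "is_field_hom c"
  shows "c a \<in> P \<longleftrightarrow> a = 0"
proof -
  interpret field_embedding c
    by unfold_locales fact
  show ?thesis
    using ring_const[of "inverse a"] by (auto simp: place_iff hom_inverse)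
qed

text \<open>A case of integral closedness: otherwise \<open>inverse z\<close> would lie in the
  place, and so would \<open>1 = inverse z ^ n * z ^ n\<close>.\<close>

lemma ring_powerD:
  assumes "z ^ n \<in> place_ring P" "n > 0"
  shows "z \<in> place_ring P"
proof (rule ccontr)
  assume *: "z \<notin> place_ring P"
  hence "inverse z \<in> P"
    by (auto simp: ring_iff)
  hence "inverse z ^ n \<in> P"
    using assms by (simp add: place_power)
  hence "inverse z ^ n * z ^ n \<in> P"
    using assms by (simp add: place_mult)
  moreover have "z \<noteq> 0"
    using * by auto
  ultimately show False
    by (simp flip: power_mult_distrib)
qed

end

lemma (in series_embedding) residue_exists:
  "\<rho> z \<in> fls_ring \<Longrightarrow> z - c (\<rho> z $$ 0) \<in> fls_place \<rho>"
  by (simp add: fls_place_def hom_diff fls_ideal_iff fls_ring_closed)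

section \<open>Simple algebraic extensions\<close>

locale simple_extension = field_embedding \<iota> for \<iota> :: "'f::field \<Rightarrow> 'e::field" +
  fixes y :: 'e
  assumes adjoin: "field_adjoin (range \<iota>) y = UNIV"
    and algebraic: "\<exists>p. p \<noteq> 0 \<and> heval y p = 0"
begin

definition minpoly :: "'f poly" where
  "minpoly = (ARG_MIN degree p. p \<noteq> 0 \<and> heval y p = 0)"

lemma minpoly_nonzero: "minpoly \<noteq> 0"
  and minpoly_root: "heval y minpoly = 0"
  and minpoly_le: "p \<noteq> 0 \<Longrightarrow> heval y p = 0 \<Longrightarrow> degree minpoly \<le> degree p"
proof -
  obtain p where "p \<noteq> 0 \<and> heval y p = 0"
    using algebraic by blast
  from arg_min_nat_lemma[of "\<lambda>p. p \<noteq> 0 \<and> heval y p = 0", OF this, of degree]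
  show "minpoly \<noteq> 0" "heval y minpoly = 0"
    "p \<noteq> 0 \<Longrightarrow> heval y p = 0 \<Longrightarrow> degree minpoly \<le> degree p" for p
    unfolding minpoly_def by auto
qed

lemma heval_mod_minpoly: "heval y (p mod minpoly) = heval y p"
proof -
  have "heval y p = heval y (p div minpoly * minpoly + p mod minpoly)"
    by (simp only: div_mult_mod_eq)
  also have "\<dots> = heval y (p mod minpoly)"
    by (simp only: heval_add heval_mult minpoly_root) simp
  finally show ?thesis ..
qed

lemma minpoly_degree_pos: "degree minpoly > 0"
proof (rule ccontr)
  assume "\<not> degree minpoly > 0"
  then obtain a where a: "minpoly = [:a:]"
    by (metis degree_eq_zeroE gr0I)
  thus False
    using minpoly_root minpoly_nonzero by simp
qed

lemma degree_mod_minpoly: "degree (p mod minpoly) < degree minpoly"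
  using degree_mod_less[OF minpoly_nonzero, of p] minpoly_degree_pos by auto

lemma minpoly_dvd: "heval y p = 0 \<Longrightarrow> minpoly dvd p"
  using heval_mod_minpoly[of p] minpoly_le[of "p mod minpoly"] degree_mod_minpoly[of p]
  by (auto simp: dvd_eq_mod_eq_0)

text \<open>Euclidean descent: with \<open>minpoly = s g + r\<close>, evaluation at \<open>y\<close>
  gives \<open>r(y) = - s(y) g(y)\<close>, so an inverse of \<open>r(y)\<close> yields one of
  \<open>g(y)\<close>. Minimality of the degree plays the part of irreducibility: it makes
  \<open>s(y)\<close> and \<open>g(y)\<close> nonzero, hence \<open>r\<close> nonzero.\<close>

lemma heval_inverse_exists:
  assumes "g \<noteq> 0" "degree g < degree minpoly"
  shows "\<exists>t. heval y t * heval y g = 1"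
  using assms
proof (induction "degree g" arbitrary: g rule: less_induct)
  case less
  show ?case
  proof (cases "degree g = 0")
    case True
    then obtain a where "g = [:a:]" "a \<noteq> 0"
      using less.prems by (metis degree_eq_zeroE pCons_0_0)
    thus ?thesis
      by (intro exI[of _ "[:inverse a:]"]) (simp add: hom_inverse)
  next
    case False
    define s where "s = minpoly div g"
    define r where "r = minpoly mod g"
    have eq: "s * g + r = minpoly"
      by (simp add: s_def r_def)
    have r: "degree r < degree g"
      using degree_mod_less[OF less.prems(1), of minpoly] False by (auto simp: r_def)
    have s0: "s \<noteq> 0"
      using eq r less.prems(2) by auto
    have "degree (s * g) \<le> degree minpoly"
    proof -
      have "degree (s * g) = degree s + degree g"
        using s0 less.prems by (simp add: degree_mult_eq)
      hence "degree r < degree (s * g)"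
        using r by simp
      hence "degree (s * g + r) = degree (s * g)"
        by (rule degree_add_eq_left)
      thus ?thesis
        by (simp add: eq)
    qed
    hence "degree s < degree minpoly"
      using False s0 less.prems by (simp add: degree_mult_eq)
    hence sy: "heval y s \<noteq> 0"
      using minpoly_le[of s] s0 by auto
    have gy: "heval y g \<noteq> 0"
      using minpoly_le[of g] less.prems by auto
    have ry: "heval y r = - heval y s * heval y g"
      using arg_cong[OF eq, of "heval y"]
      by (simp add: heval_add heval_mult minpoly_root eq_neg_iff_add_eq_0 add.commute)
    hence "r \<noteq> 0"
      using sy gy by auto
    then obtain t where "heval y t * heval y r = 1"
      using less.hyps[of r] r less.prems(2) by auto
    hence "heval y (- (t * s)) * heval y g = 1"
      by (simp add: ry heval_mult heval_diff flip: diff_0) (simp add: mult_ac)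
    thus ?thesis
      by blast
  qed
qed

text \<open>The polynomials in \<open>y\<close> are already closed under inverses, so adjoining
  \<open>y\<close> brings no further quotients.\<close>

lemma heval_surj: "\<exists>g. z = heval y g"
proof -
  have "is_subfield (range (heval y))"
    unfolding is_subfield_def is_subring_def
  proof (intro conjI ballI)
    show "0 \<in> range (heval y)" "1 \<in> range (heval y)"
      by (metis heval_0 rangeI, metis heval_1 rangeI)
    fix z assume z: "z \<in> range (heval y)"
    then obtain g where g: "z = heval y (g mod minpoly)"
      by (auto simp: heval_mod_minpoly)
    show "inverse z \<in> range (heval y)"
    proof (cases "g mod minpoly = 0")
      case True
      thus ?thesis
        using z g by simp
    next
      case False
      then obtain t where "heval y t * z = 1"
        using heval_inverse_exists[of "g mod minpoly"] degree_mod_minpoly g by blast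
      hence "inverse z = heval y t"
        by (metis inverse_unique mult.commute)
      thus ?thesis
        by simp
    qed
    fix w assume "w \<in> range (heval y)"
    with z show "z - w \<in> range (heval y)" "z * w \<in> range (heval y)"
      by (auto simp flip: heval_diff heval_mult)
  qed
  moreover have "\<iota> a = heval y [:a:]" for a
    by simp
  hence "range \<iota> \<subseteq> range (heval y)"
    by blast
  moreover have "y = heval y [:0, 1:]"
    by simp
  hence "y \<in> range (heval y)"
    by blast
  ultimately have "field_adjoin (range \<iota>) y \<subseteq> range (heval y)"
    by (auto simp: field_adjoin_def)
  thus ?thesis
    using adjoin by blast
qed

lemma ext_degree_eq: "ext_degree \<iota> = degree minpoly"
proof -
  interpret V: vector_space "\<lambda>a v. \<iota> a * v"
    by unfold_locales (simp_all add: hom_add hom_mult algebra_simps)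
  define B where "B = (\<lambda>i. y ^ i) ` {..<degree minpoly}"
  have indep: "p = 0" if "heval y p = 0" "\<And>i. i \<ge> degree minpoly \<Longrightarrow> coeff p i = 0" for p
  proof (rule ccontr)
    assume "p \<noteq> 0"
    hence "degree p < degree minpoly"
      using that(2)[of "degree p"] by (metis leading_coeff_0_iff not_le)
    thus False
      using minpoly_le[OF \<open>p \<noteq> 0\<close> that(1)] by simp
  qed
  \<comment> \<open>\<open>B\<close> is a set, so its cardinality is the degree only if these powers
    are distinct.\<close>
  have inj: "inj_on (\<lambda>i. y ^ i) {..<degree minpoly}"
  proof (rule inj_onI)
    fix i j assume ij: "i \<in> {..<degree minpoly}" "j \<in> {..<degree minpoly}" "y ^ i = y ^ j"
    have "monom 1 i - monom 1 j = (0 :: 'f poly)"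
      using ij by (intro indep) (auto simp: heval_diff heval_monom)
    hence "coeff (monom 1 i - monom 1 j :: 'f poly) i = 0"
      by simp
    thus "i = j"
      by (simp split: if_splits)
  qed
  have "V.independent B"
  proof
    assume "V.dependent B"
    then obtain u v where uv: "v \<in> B" "u v \<noteq> 0" "(\<Sum>v\<in>B. \<iota> (u v) * v) = 0"
      by (subst (asm) V.dependent_finite) (auto simp: B_def)
    define p where "p = (\<Sum>i<degree minpoly. monom (u (y ^ i)) i)"
    have cp: "coeff p i = (if i < degree minpoly then u (y ^ i) else 0)" for i
      by (simp add: p_def coeff_sum)
    have "heval y p = (\<Sum>i<degree minpoly. \<iota> (u (y ^ i)) * y ^ i)"
      by (simp add: p_def heval_monom heval_sum)
    also have "\<dots> = 0"
      using uv(3) inj by (simp add: B_def sum.reindex)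
    finally have "p = 0"
      using cp by (intro indep) auto
    moreover obtain i where "i < degree minpoly" "v = y ^ i"
      using uv(1) by (auto simp: B_def)
    ultimately show False
      using cp[of i] uv(2) by simp
  qed
  moreover have "UNIV \<subseteq> V.span B"
  proof
    fix z :: 'e
    obtain g where "z = heval y (g mod minpoly)"
      using heval_surj heval_mod_minpoly by metis
    also have "\<dots> = (\<Sum>i\<le>degree (g mod minpoly). \<iota> (coeff (g mod minpoly) i) * y ^ i)"
      by (rule heval_altdef)
    also have "\<dots> \<in> V.span B"
      using degree_mod_minpoly[of g]
      by (intro V.span_sum V.span_scale V.span_base) (auto simp: B_def)
    finally show "z \<in> V.span B" .
  qed
  ultimately have "V.dim UNIV = card B"
    by (intro V.dim_eq_card) auto
  thus ?thesis
    using inj by (simp add: ext_degree_def B_def card_image)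
qed

lemma extend_hom:
  fixes \<rho> :: "'f \<Rightarrow> 'l::field"
  assumes "is_field_hom \<rho>" and root: "field_embedding.heval \<rho> \<eta> minpoly = 0"
  obtains \<sigma> where "is_field_hom \<sigma>" "\<And>g. \<sigma> (heval y g) = field_embedding.heval \<rho> \<eta> g"
proof -
  interpret R: field_embedding \<rho>
    by unfold_locales fact
  \<comment> \<open>The choice of \<open>g\<close> does not matter: two candidates differ by a
    multiple of \<open>minpoly\<close>, which vanishes at \<open>\<eta>\<close>.\<close>
  define \<sigma> where "\<sigma> = (\<lambda>z. R.heval \<eta> (SOME g. z = heval y g))"
  have \<sigma>: "\<sigma> (heval y g) = R.heval \<eta> g" for g
  proof -
    have "heval y g = heval y (SOME h. heval y g = heval y h)"
      by (rule someI) auto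
    hence "minpoly dvd g - (SOME h. heval y g = heval y h)"
      by (intro minpoly_dvd) (simp add: heval_diff)
    then obtain k where "g - (SOME h. heval y g = heval y h) = minpoly * k" ..
    hence "R.heval \<eta> (g - (SOME h. heval y g = heval y h)) = 0"
      using root by (simp add: R.heval_mult)
    thus ?thesis
      by (simp add: \<sigma>_def R.heval_diff)
  qed
  have "is_field_hom \<sigma>"
    unfolding is_field_hom_def
  proof (intro conjI allI)
    show "\<sigma> 1 = 1"
      using \<sigma>[of 1] by simp
    fix z w
    obtain g h where "z = heval y g" "w = heval y h"
      using heval_surj by meson
    thus "\<sigma> (z + w) = \<sigma> z + \<sigma> w" "\<sigma> (z * w) = \<sigma> z * \<sigma> w"
      by (simp_all add: \<sigma> R.heval_add R.heval_mult flip: heval_add heval_mult)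
  qed
  thus ?thesis
    using that \<sigma> by blast
qed

end

text \<open>Both sides have degree at most \<open>m\<close>, the same coefficient at
  \<open>m\<close>, and the value 0 at the \<open>m\<close> roots of unity. The factorization is
  used to find the residue of \<open>y\<close> at a place.\<close>

lemma prod_roots_of_unity:
  assumes "card {\<zeta>::'k::field. \<zeta> ^ m = 1} = m" "m > 0"
  shows "(\<Prod>\<zeta> | \<zeta> ^ m = 1. [:- \<zeta>, 1:]) = monom (1::'k) m - 1"
proof -
  have fin: "finite {\<zeta>::'k. \<zeta> ^ m = 1}"
    using assms by (intro card_ge_0_finite) simp
  have deg: "degree (\<Prod>\<zeta> | \<zeta> ^ m = 1. [:- \<zeta>, 1::'k:]) = m"
    by (subst degree_prod_eq_sum_degree) (simp_all add: assms)
  have "lead_coeff (\<Prod>\<zeta> | \<zeta> ^ m = 1. [:- \<zeta>, 1::'k:]) = 1"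
    by (simp add: lead_coeff_prod)
  with deg have "coeff (\<Prod>\<zeta> | \<zeta> ^ m = 1. [:- \<zeta>, 1::'k:]) m = 1"
    by simp
  show ?thesis
  proof (rule poly_eqI_degree_lead_coeff)
    show "coeff (\<Prod>\<zeta> | \<zeta> ^ m = 1. [:- \<zeta>, 1::'k:]) m = coeff (monom 1 m - 1) m"
      using \<open>coeff _ m = 1\<close> assms by simp
    show "m \<le> card {\<zeta>::'k. \<zeta> ^ m = 1}"
      using assms by simp
    show "degree (\<Prod>\<zeta> | \<zeta> ^ m = 1. [:- \<zeta>, 1::'k:]) \<le> m"
      using deg by simp
    show "degree (monom (1::'k) m - 1) \<le> m"
      by (intro degree_diff_le) (auto simp: degree_monom_le)
    fix z :: 'k assume "z \<in> {\<zeta>. \<zeta> ^ m = 1}"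
    thus "poly (\<Prod>\<zeta> | \<zeta> ^ m = 1. [:- \<zeta>, 1:]) z = poly (monom 1 m - 1) z"
      using fin by (auto simp: poly_prod poly_monom)
  qed
qed

section \<open>Residues in the constant field, and density of the base field in the series\<close>

context function_place
begin

text \<open>A relation instead of a function, because at a place not known to be rational an element
  of the ring need not be congruent to a constant.\<close>

definition has_residue :: "'a \<Rightarrow> 'k \<Rightarrow> bool" where
  "has_residue z a \<longleftrightarrow> z - c a \<in> P"

lemma has_residue_ring: "has_residue z a \<Longrightarrow> z \<in> place_ring P"
  using ring_add[of "z - c a" "c a"] by (simp add: has_residue_def place_in_ring)

context
  assumes hom: "is_field_hom c"
begin

interpretation field_embedding c
  by unfold_locales (rule hom)

lemma has_residue_const: "has_residue (c a) a"
  by (simp add: has_residue_def)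

lemma has_residue_add: "has_residue z a \<Longrightarrow> has_residue w b \<Longrightarrow> has_residue (z + w) (a + b)"
  using place_add[of "z - c a" "w - c b"] by (simp add: has_residue_def hom_add algebra_simps)

lemma has_residue_mult:
  assumes "has_residue z a" "has_residue w b"
  shows "has_residue (z * w) (a * b)"
proof -
  have "(z - c a) * w + c a * (w - c b) \<in> P"
    using assms by (intro place_add place_mult place_mult' has_residue_ring ring_const)
      (auto simp: has_residue_def)
  thus ?thesis
    by (simp add: has_residue_def hom_mult algebra_simps)
qed

lemma has_residue_power: "has_residue z a \<Longrightarrow> has_residue (z ^ n) (a ^ n)"
  by (induction n) (auto intro: has_residue_mult has_residue_const simp flip: hom_1)

lemma has_residue_sum:
  "(\<And>i. i \<in> A \<Longrightarrow> has_residue (f i) (r i)) \<Longrightarrow> has_residue (sum f A) (sum r A)"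
  by (induction A rule: infinite_finite_induct)
    (auto intro: has_residue_add has_residue_const simp flip: hom_0)

lemma has_residue_place_iff: "has_residue z a \<Longrightarrow> z \<in> P \<longleftrightarrow> a = 0"
  using place_diff[of z "z - c a"] const_in_place_iff[OF hom, of a]
  by (auto simp: has_residue_def)

end

end

context series_embedding
begin

lemma const_hom: "is_field_hom c"
proof -
  have "c (a + b) = c a + c b" "c (a * b) = c a * c b" "c 1 = 1" for a b
    by (simp_all add: hom_add hom_mult fls_plus_const flip: hom_eq_iff)
  thus ?thesis
    by (simp add: is_field_hom_def)
qed

text \<open>A truncation of the series is a polynomial in the parameter over the constants, hence
  the image of an element of the base field. It has at least one term, so that the residue is right
  whatever the order of \<open>\<rho> e\<close>.\<close>

lemma dense:
  assumes "v \<in> fls_ring" "e \<noteq> 0"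
  shows "\<exists>d. (v - \<rho> d) / \<rho> e \<in> fls_ring \<and> v - \<rho> d \<in> fls_ideal"
proof -
  obtain f where v: "v = fps_to_fls f"
    using assms by (auto simp: fls_ring_iff)
  define N where "N = max 1 (nat (fls_subdegree (\<rho> e)))"
  define d where "d = (\<Sum>i<N. c (f $ i) * \<tau> ^ i)"
  define h where "h = f - (\<Sum>i<N. fps_const (f $ i) * fps_X ^ i)"
  have "\<rho> d = fps_to_fls (\<Sum>i<N. fps_const (f $ i) * fps_X ^ i)"
  proof -
    have "fps_to_fls (sum F A) = (\<Sum>i\<in>A. fps_to_fls (F i))" for F :: "nat \<Rightarrow> 'k fps" and A
      by (induction A rule: infinite_finite_induct) simp_all
    thus ?thesis
      by (simp add: d_def hom_sum hom_mult hom_power fls_times_fps_to_fls fps_to_fls_power)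
  qed
  hence vd: "v - \<rho> d = fps_to_fls h"
    by (simp add: v h_def)
  have "h $ i = 0" if "i < N" for i
    using that by (simp add: h_def fps_sum_nth if_distrib cong: if_cong)
  hence "h = 0 \<or> subdegree h \<ge> N"
    by (metis subdegree_geI)
  hence "v - \<rho> d = 0 \<or> fls_subdegree (v - \<rho> d) \<ge> int N"
    by (auto simp: vd fls_subdegree_fls_to_fps)
  moreover have "int N \<ge> 1" "int N \<ge> fls_subdegree (\<rho> e)"
    by (auto simp: N_def)
  ultimately show ?thesis
    using assms(2) by (intro exI[of _ d]) (auto simp: fls_divide_in_ring_iff fls_ideal_def)
qed

end

section \<open>Splitting of a place\<close>

text \<open>Here \<open>u\<close> is a unit at the place; at the pole of \<open>x\<close> this is
  arranged by rescaling \<open>y\<close>. The polynomial \<open>X^m - u\<close> may be reducible, so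
  the degree of the extension is read off the minimal polynomial of \<open>y\<close> and not off
  \<open>m\<close>.\<close>

locale kummer_place =
  S: series_embedding \<rho> c \<tau> + field_embedding \<iota>
  for \<rho> :: "'f::field \<Rightarrow> 'k::field fls" and c \<tau> and \<iota> :: "'f \<Rightarrow> 'e::field" +
  fixes y :: 'e and u :: 'f and m :: nat and \<beta> :: 'k
  assumes gen: "field_adjoin (range \<iota>) y = UNIV"
    and y_power: "y ^ m = \<iota> u"
    and u_ring: "\<rho> u \<in> fls_ring" and u_residue: "\<rho> u $$ 0 = \<beta> ^ m"
    and \<beta>_nonzero: "\<beta> \<noteq> 0"
    and m_nonzero: "of_nat m \<noteq> (0::'k)"
    and roots_of_unity: "card {\<zeta>::'k. \<zeta> ^ m = 1} = m"
begin

lemma m_pos: "m > 0"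
  using m_nonzero by (cases m) auto

sublocale simple_extension \<iota> y
proof
  show "\<exists>p. p \<noteq> 0 \<and> heval y p = 0"
  proof (intro exI conjI)
    have "coeff (monom 1 m - [:u:]) m = 1"
      using m_pos by (simp add: coeff_pCons split: nat.splits)
    thus "monom 1 m - [:u:] \<noteq> 0"
      by (metis coeff_0 zero_neq_one)
    show "heval y (monom 1 m - [:u:]) = 0"
      by (simp add: heval_diff heval_monom y_power)
  qed
qed (rule gen)

definition \<theta> :: "'k fls" where
  "\<theta> = (SOME t. t \<in> fls_ring \<and> t ^ m = \<rho> u \<and> t $$ 0 = \<beta>)"

lemma \<theta>_ring: "\<theta> \<in> fls_ring" and \<theta>_power: "\<theta> ^ m = \<rho> u" and \<theta>_residue: "\<theta> $$ 0 = \<beta>"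
proof -
  obtain v where v: "\<rho> u = fps_to_fls v"
    using u_ring by (auto simp: fls_ring_iff)
  hence "\<beta> ^ m = v $ 0"
    using u_residue by simp
  then obtain r where "r ^ m = v" "r $ 0 = \<beta>"
    using fps_nth_root_exists \<beta>_nonzero m_nonzero by blast
  hence "fps_to_fls r \<in> fls_ring \<and> fps_to_fls r ^ m = \<rho> u \<and> fps_to_fls r $$ 0 = \<beta>"
    by (simp add: v flip: fps_to_fls_power)
  from someI[of "\<lambda>t. t \<in> fls_ring \<and> t ^ m = \<rho> u \<and> t $$ 0 = \<beta>", OF this]
  show "\<theta> \<in> fls_ring" "\<theta> ^ m = \<rho> u" "\<theta> $$ 0 = \<beta>"
    unfolding \<theta>_def by blast+
qed

lemma \<theta>_nonzero: "\<theta> \<noteq> 0"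
  using \<theta>_residue \<beta>_nonzero by auto

definition conjugates :: "'k fls set" where
  "conjugates = {\<eta>. S.heval \<eta> minpoly = 0}"

text \<open>
  All \<open>m\<close> roots of \<open>X\<^sup>m - u\<close> lie in the Laurent series, so the factor \<open>minpoly\<close> has as many roots
  there as its degree.
\<close>

lemma mth_roots: "{\<eta>. \<eta> ^ m = \<rho> u} = (\<lambda>\<zeta>. \<theta> * fls_const \<zeta>) ` {\<zeta>. \<zeta> ^ m = 1}"
  and card_conjugates: "card conjugates = degree minpoly"
  and conjugates_subset: "conjugates \<subseteq> {\<eta>. \<eta> ^ m = \<rho> u}"
  and finite_conjugates: "finite conjugates"
proof -
  define p where "p = monom 1 m - [:u:]"
  have "coeff p m = 1"
    using m_pos by (simp add: p_def coeff_pCons split: nat.splits)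
  hence p0: "p \<noteq> 0"
    by auto
  have degp: "degree p \<le> m"
    unfolding p_def by (intro degree_diff_le) (auto simp: degree_monom_le)
  have pe: "S.heval \<eta> p = \<eta> ^ m - \<rho> u" for \<eta>
    by (simp add: p_def S.heval_diff S.heval_monom)
  have "heval y p = 0"
    by (simp add: p_def heval_diff heval_monom y_power)
  then obtain e where e: "p = minpoly * e"
    using minpoly_dvd by blast
  have fin: "finite {\<eta>. S.heval \<eta> q = 0}" and bound: "card {\<eta>. S.heval \<eta> q = 0} \<le> degree q"
    if "q \<noteq> 0" for q
    using that poly_roots_finite[of "map_poly \<rho> q"] card_poly_roots_bound[of "map_poly \<rho> q"]
    by (auto simp: S.heval_def)
  have W: "{\<eta>. \<eta> ^ m = \<rho> u} = {\<eta>. S.heval \<eta> p = 0}"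
    by (simp add: pe)
  have sub: "(\<lambda>\<zeta>. \<theta> * fls_const \<zeta>) ` {\<zeta>. \<zeta> ^ m = 1} \<subseteq> {\<eta>. \<eta> ^ m = \<rho> u}"
    by (auto simp: power_mult_distrib \<theta>_power simp flip: fls_const_power)
  have "inj_on (\<lambda>\<zeta>. \<theta> * fls_const \<zeta>) {\<zeta>. \<zeta> ^ m = 1}"
  proof (rule inj_onI)
    fix a b assume "\<theta> * fls_const a = \<theta> * fls_const b"
    hence "fls_const a $$ 0 = fls_const b $$ 0"
      using \<theta>_nonzero by simp
    thus "a = b"
      by simp
  qed
  hence ci: "card ((\<lambda>\<zeta>. \<theta> * fls_const \<zeta>) ` {\<zeta>. \<zeta> ^ m = 1}) = m"
    by (simp add: card_image roots_of_unity)
  show eq: "{\<eta>. \<eta> ^ m = \<rho> u} = (\<lambda>\<zeta>. \<theta> * fls_const \<zeta>) ` {\<zeta>. \<zeta> ^ m = 1}"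
    by (rule card_seteq[OF _ sub, symmetric])
      (use fin[OF p0] bound[OF p0] degp ci in \<open>simp_all add: W\<close>)
  have e0: "e \<noteq> 0"
    using e p0 by auto
  \<comment> \<open>The \<open>m\<close> roots are shared between the two factors, whose degrees add
    up to at most \<open>m\<close>; so neither factor can have fewer roots than its degree.\<close>
  have "{\<eta>. \<eta> ^ m = \<rho> u} = conjugates \<union> {\<eta>. S.heval \<eta> e = 0}"
    unfolding W e conjugates_def by (auto simp: S.heval_mult)
  moreover from this show "conjugates \<subseteq> {\<eta>. \<eta> ^ m = \<rho> u}"
    by blast
  ultimately have "m \<le> card conjugates + card {\<eta>. S.heval \<eta> e = 0}"
    by (metis card_Un_le ci eq)
  moreover have "card {\<eta>. S.heval \<eta> e = 0} \<le> degree e"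
    by (rule bound[OF e0])
  moreover have "card conjugates \<le> degree minpoly"
    unfolding conjugates_def by (rule bound[OF minpoly_nonzero])
  moreover have "degree p = degree minpoly + degree e"
    unfolding e using minpoly_nonzero e0 by (rule degree_mult_eq)
  ultimately show "card conjugates = degree minpoly"
    using degp by linarith
  show "finite conjugates"
    unfolding conjugates_def by (rule fin[OF minpoly_nonzero])
qed

lemma mth_root_in_ring:
  assumes "\<eta> ^ m = \<rho> u"
  shows "\<eta> \<in> fls_ring"
proof -
  obtain \<zeta> where "\<eta> = \<theta> * fls_const \<zeta>"
    using assms mth_roots by blast
  thus ?thesis
    by (simp add: fls_ring_closed \<theta>_ring)
qed

text \<open>All roots are constant multiples of \<open>\<theta>\<close>, whose residue
  \<open>\<beta>\<close> is nonzero, so the residue reveals the constant.\<close>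

lemma mth_root_eqI:
  assumes "\<eta> ^ m = \<rho> u" "\<eta>' ^ m = \<rho> u" "\<eta> $$ 0 = \<eta>' $$ 0"
  shows "\<eta> = \<eta>'"
proof -
  obtain a b where "\<eta> = \<theta> * fls_const a" "\<eta>' = \<theta> * fls_const b"
    using assms mth_roots by blast
  with assms(3) show ?thesis
    using \<beta>_nonzero by (simp add: fls_residue_mult \<theta>_ring \<theta>_residue)
qed

definition extension :: "'k fls \<Rightarrow> 'e \<Rightarrow> 'k fls" where
  "extension \<eta> = (SOME \<sigma>. is_field_hom \<sigma> \<and> (\<forall>g. \<sigma> (heval y g) = S.heval \<eta> g))"

lemma extension:
  assumes "\<eta> \<in> conjugates"
  shows extension_hom: "is_field_hom (extension \<eta>)"
    and extension_heval: "extension \<eta> (heval y g) = S.heval \<eta> g"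
proof -
  have "\<exists>\<sigma>. is_field_hom \<sigma> \<and> (\<forall>g. \<sigma> (heval y g) = S.heval \<eta> g)"
    using extend_hom[OF S.field_hom, of \<eta>] assms unfolding conjugates_def by blast
  from someI_ex[OF this] show "is_field_hom (extension \<eta>)" "extension \<eta> (heval y g) = S.heval \<eta> g"
    unfolding extension_def by blast+
qed

lemma extension_\<iota>: "\<eta> \<in> conjugates \<Longrightarrow> extension \<eta> (\<iota> a) = \<rho> a"
  using extension_heval[of \<eta> "[:a:]"] by simp

lemma extension_y: "\<eta> \<in> conjugates \<Longrightarrow> extension \<eta> y = \<eta>"
  using extension_heval[of \<eta> "[:0, 1:]"] by simp

lemma series_embedding_extension:
  assumes "\<eta> \<in> conjugates"
  shows "series_embedding (extension \<eta>) (\<iota> \<circ> c) (\<iota> \<tau>)"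
  by unfold_locales (simp_all add: extension_hom extension_\<iota> assms)

text \<open>The constant congruent to \<open>y\<close> can be read off the place, and it determines
  the conjugate by \<open>mth_root_eqI\<close>.\<close>

lemma fls_place_extension_inj: "inj_on (\<lambda>\<eta>. fls_place (extension \<eta>)) conjugates"
proof (rule inj_onI)
  fix \<eta> \<eta>' assume \<eta>: "\<eta> \<in> conjugates" "\<eta>' \<in> conjugates"
    and eq: "fls_place (extension \<eta>) = fls_place (extension \<eta>')"
  interpret A: series_embedding "extension \<eta>" "\<iota> \<circ> c" "\<iota> \<tau>"
    using \<eta> by (intro series_embedding_extension)
  interpret B: series_embedding "extension \<eta>'" "\<iota> \<circ> c" "\<iota> \<tau>"
    using \<eta> by (intro series_embedding_extension)
  have roots: "\<eta> ^ m = \<rho> u" "\<eta>' ^ m = \<rho> u"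
    using \<eta> conjugates_subset by auto
  have "y - (\<iota> \<circ> c) (\<eta> $$ 0) \<in> fls_place (extension \<eta>)"
    using A.residue_exists[of y] \<eta> roots by (simp add: extension_y mth_root_in_ring)
  hence "y - \<iota> (c (\<eta> $$ 0)) \<in> fls_place (extension \<eta>')"
    using eq by simp
  hence "extension \<eta>' (y - \<iota> (c (\<eta> $$ 0))) \<in> fls_ideal"
    by (simp add: fls_place_def)
  hence "\<eta>' - fls_const (\<eta> $$ 0) \<in> fls_ideal"
    using \<eta> by (simp add: B.hom_diff extension_y extension_\<iota>)
  hence "\<eta>' $$ 0 = \<eta> $$ 0"
    by (simp add: fls_ideal_iff)
  thus "\<eta> = \<eta>'"
    using mth_root_eqI roots by metis
qed

end

section \<open>Uniqueness: an arbitrary place above the given one\<close>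

locale kummer_place_above = kummer_place +
  fixes Q :: "'c set"
  assumes place_Q: "is_place (\<iota> \<circ> c) Q" and above: "\<iota> ` fls_place \<rho> \<subseteq> Q"
begin

sublocale Q: function_place "\<iota> \<circ> c" Q
  by unfold_locales (rule place_Q)

lemma hom_\<iota>c: "is_field_hom (\<iota> \<circ> c)"
  by (intro is_field_hom_compose field_hom S.const_hom)

lemma residue_lift: "\<rho> z \<in> fls_ring \<Longrightarrow> Q.has_residue (\<iota> z) (\<rho> z $$ 0)"
  using S.residue_exists[of z] above by (auto simp: Q.has_residue_def hom_diff)

lemma \<tau>_in_place: "\<iota> \<tau> \<in> Q"
proof -
  have "\<tau> \<in> fls_place \<rho>"
    by (simp add: fls_place_def fls_X_in_ideal)
  thus ?thesis
    using above by auto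
qed

lemma ring_lift: "\<rho> z \<in> fls_ring \<Longrightarrow> \<iota> z \<in> place_ring Q"
  using residue_lift Q.has_residue_ring by blast

text \<open>
  The pairs \<open>(z, v)\<close> having common approximations \<open>d\<close> in the base field, in the \<open>Q\<close>-adic and in the
  \<open>t\<close>-adic topology.
\<close>

definition approx :: "'c \<Rightarrow> 'b fls \<Rightarrow> bool" where
  "approx z v \<longleftrightarrow>
     (\<forall>e. e \<noteq> 0 \<longrightarrow> (\<exists>d. (z - \<iota> d) / \<iota> e \<in> place_ring Q \<and> (v - \<rho> d) / \<rho> e \<in> fls_ring))"

lemma approx_\<iota>: "approx (\<iota> a) (\<rho> a)"
  by (auto simp: approx_def intro!: exI[of _ a])

lemma approx_add:
  assumes "approx z v" "approx z' v'"
  shows "approx (z + z') (v + v')"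
  unfolding approx_def
proof (intro allI impI)
  fix e :: 'a assume "e \<noteq> 0"
  obtain d d' where d: "(z - \<iota> d) / \<iota> e \<in> place_ring Q" "(v - \<rho> d) / \<rho> e \<in> fls_ring"
    "(z' - \<iota> d') / \<iota> e \<in> place_ring Q" "(v' - \<rho> d') / \<rho> e \<in> fls_ring"
    using assms \<open>e \<noteq> 0\<close> unfolding approx_def by meson
  have "(z + z' - \<iota> (d + d')) / \<iota> e = (z - \<iota> d) / \<iota> e + (z' - \<iota> d') / \<iota> e"
    "(v + v' - \<rho> (d + d')) / \<rho> e = (v - \<rho> d) / \<rho> e + (v' - \<rho> d') / \<rho> e"
    using \<open>e \<noteq> 0\<close> by (simp_all add: hom_add S.hom_add field_simps)
  thus "\<exists>d. (z + z' - \<iota> d) / \<iota> e \<in> place_ring Q \<and> (v + v' - \<rho> d) / \<rho> e \<in> fls_ring"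
    using d Q.ring_add fls_ring_closed by metis
qed

lemma approx_mult:
  assumes "approx z v" "approx z' v'" "z' \<in> place_ring Q" "v' \<in> fls_ring"
  shows "approx (z' * z) (v' * v)"
  unfolding approx_def
proof (intro allI impI)
  fix e :: 'a assume e: "e \<noteq> 0"
  obtain d where d: "(z - \<iota> d) / \<iota> e \<in> place_ring Q" "(v - \<rho> d) / \<rho> e \<in> fls_ring"
    using assms e unfolding approx_def by meson
  \<comment> \<open>In \<open>z' z - d' d = z' (z - d) + (z' - d') d\<close> the second error is
    multiplied by \<open>d\<close>, so \<open>d'\<close> is taken with precision
    \<open>e / d\<close>. For \<open>d = 0\<close> the second error vanishes, and the division would
    only produce 0.\<close>
  obtain d' where d': "d \<noteq> 0 \<Longrightarrow> (z' - \<iota> d') / \<iota> (e / d) \<in> place_ring Q"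
    "d \<noteq> 0 \<Longrightarrow> (v' - \<rho> d') / \<rho> (e / d) \<in> fls_ring"
    using assms(2) e unfolding approx_def by (metis divide_eq_0_iff)
  have "(z' * z - \<iota> (d' * d)) / \<iota> e \<in> place_ring Q"
  proof (cases "d = 0")
    case True
    thus ?thesis
      using Q.ring_mult[OF assms(3) d(1)] by simp
  next
    case False
    have "z' * ((z - \<iota> d) / \<iota> e) + (z' - \<iota> d') / \<iota> (e / d) \<in> place_ring Q"
      using d d' False assms by (intro Q.ring_add Q.ring_mult)
    also have "z' * ((z - \<iota> d) / \<iota> e) + (z' - \<iota> d') / \<iota> (e / d) = (z' * z - \<iota> (d' * d)) / \<iota> e"
      using False e by (simp add: hom_divide hom_mult field_simps)
    finally show ?thesis .
  qed
  moreover have "(v' * v - \<rho> (d' * d)) / \<rho> e \<in> fls_ring"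
  proof (cases "d = 0")
    case True
    thus ?thesis
      using fls_ring_closed(3)[OF assms(4) d(2)] by simp
  next
    case False
    have "v' * ((v - \<rho> d) / \<rho> e) + (v' - \<rho> d') / \<rho> (e / d) \<in> fls_ring"
      using d d' False assms by (intro fls_ring_closed)
    also have "v' * ((v - \<rho> d) / \<rho> e) + (v' - \<rho> d') / \<rho> (e / d) = (v' * v - \<rho> (d' * d)) / \<rho> e"
      using False e by (simp add: S.hom_divide S.hom_mult field_simps)
    finally show ?thesis .
  qed
  ultimately show "\<exists>d. (z' * z - \<iota> d) / \<iota> e \<in> place_ring Q \<and> (v' * v - \<rho> d) / \<rho> e \<in> fls_ring"
    by blast
qed

text \<open>Approximated to one power of the parameter beyond the order \<open>k\<close> of
  \<open>v\<close>, the element \<open>d\<close> has the same order \<open>k\<close>, and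
  \<open>z\<close> differs from \<open>\<iota> d\<close> by a multiple of the next power. So the
  order of \<open>v\<close> in K((t)) is the order of \<open>z\<close> at \<open>Q\<close>, although
  \<open>Q\<close> is not known to be discrete.\<close>

lemma approx_order:
  assumes "approx z v" "v \<noteq> 0"
  obtains w where "w \<in> place_ring Q" "w \<notin> Q" "z = \<iota> \<tau> powi fls_subdegree v * w"
proof -
  define k where "k = fls_subdegree v"
  define e where "e = \<tau> powi (k + 1)"
  have e0: "e \<noteq> 0"
    by (simp add: e_def S.param_nonzero)
  have \<tau>0: "\<iota> \<tau> \<noteq> 0"
    by (simp add: S.param_nonzero)
  obtain d where d: "(z - \<iota> d) / \<iota> e \<in> place_ring Q" "(v - \<rho> d) / \<rho> e \<in> fls_ring"
    using assms e0 unfolding approx_def by meson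
  have "fls_subdegree (\<rho> e) = k + 1"
    unfolding e_def S.hom_power_int by simp
  hence "v - \<rho> d = 0 \<or> fls_subdegree (v - \<rho> d) > k"
    using d(2) e0 by (auto simp: fls_divide_in_ring_iff)
  hence "fls_subdegree (v - (v - \<rho> d)) = k \<and> v - (v - \<rho> d) \<noteq> 0"
    using assms(2) fls_subdegree_diff_eq1[of v "v - \<rho> d"] unfolding k_def
    by (metis diff_0_right eq_iff_diff_eq_0 less_irrefl)
  hence dk: "fls_subdegree (\<rho> d) = k" "d \<noteq> 0"
    by auto
  define d' where "d' = d / \<tau> powi k"
  have d'0: "d' \<noteq> 0"
    using dk by (simp add: d'_def S.param_nonzero)
  have "\<rho> d' = \<rho> d / fls_X powi k"
    unfolding d'_def S.hom_divide S.hom_power_int by simp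
  hence "fls_subdegree (\<rho> d') = 0"
    using dk by (simp add: fls_divide_subdegree)
  hence d'r: "\<rho> d' \<in> fls_ring" "\<rho> d' $$ 0 \<noteq> 0"
    using d'0 nth_fls_subdegree_nonzero[of "\<rho> d'"] by (auto simp: fls_ring_def)
  define w where "w = \<iota> d' + \<iota> \<tau> * ((z - \<iota> d) / \<iota> e)"
  have in_Q: "\<iota> \<tau> * ((z - \<iota> d) / \<iota> e) \<in> Q"
    using d by (intro Q.place_mult \<tau>_in_place)
  have "\<iota> d' \<notin> Q"
    using residue_lift[OF d'r(1)] d'r(2) Q.has_residue_place_iff[OF hom_\<iota>c] by blast
  hence "w \<notin> Q"
    unfolding w_def using in_Q ring_lift[OF d'r(1)] by (intro Q.unit_add)
  moreover have "w \<in> place_ring Q"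
    unfolding w_def using ring_lift[OF d'r(1)] Q.place_in_ring[OF in_Q] by (rule Q.ring_add)
  moreover have "z = \<iota> \<tau> powi k * w"
  proof -
    define t where "t = \<iota> \<tau> powi k"
    have t: "t \<noteq> 0"
      using \<tau>0 by (simp add: t_def)
    have e: "\<iota> e = t * \<iota> \<tau>"
      using \<tau>0 unfolding e_def hom_power_int t_def by (subst power_int_add) auto
    have d': "\<iota> d' = \<iota> d / t"
      unfolding d'_def t_def by (simp only: hom_divide hom_power_int)
    have "t * w = z"
      unfolding w_def d' e using t \<tau>0 by (simp add: field_simps)
    thus ?thesis
      by (simp add: t_def)
  qed
  ultimately show ?thesis
    using that by (simp add: k_def)
qed

lemma y_in_ring: "y \<in> place_ring Q"
  using Q.ring_powerD[of y m] ring_lift[OF u_ring] m_pos by (simp add: y_power)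

text \<open>Modulo \<open>Q\<close>, the element \<open>(y / b) ^ m - 1\<close> vanishes and splits
  into linear factors, since the constants contain all \<open>m\<close> roots of unity. As
  \<open>Q\<close> is prime, one factor lies in it.\<close>

lemma y_residue: obtains \<zeta> where "\<zeta> ^ m = 1" "Q.has_residue y (\<beta> * \<zeta>)"
proof -
  interpret C: field_embedding "\<iota> \<circ> c"
    by unfold_locales (rule hom_\<iota>c)
  define b where "b = (\<iota> \<circ> c) \<beta>"
  have b0: "b \<noteq> 0"
    using \<beta>_nonzero unfolding b_def by (subst C.hom_eq_0_iff)
  have fin: "finite {\<zeta>::'b. \<zeta> ^ m = 1}"
    using roots_of_unity m_pos by (intro card_ge_0_finite) simp
  have "y ^ m - b ^ m \<in> Q"
    using residue_lift[OF u_ring] by (simp add: Q.has_residue_def u_residue y_power b_def hom_power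
      S.const_hom field_embedding.hom_power[OF field_embedding.intro])
  moreover have binv: "inverse b \<in> place_ring Q"
    using Q.ring_const[of "inverse \<beta>"] by (simp add: b_def C.hom_inverse[unfolded comp_def])
  ultimately have "(y ^ m - b ^ m) * inverse b ^ m \<in> Q"
    by (intro Q.place_mult Q.ring_power)
  also have "(y ^ m - b ^ m) * inverse b ^ m = (y / b) ^ m - 1"
    using b0 by (simp add: field_simps)
  also have "\<dots> = C.heval (y / b) (monom 1 m - 1)"
    using C.hom_1 by (simp add: C.heval_diff C.heval_monom)
  also have "\<dots> = (\<Prod>\<zeta> | \<zeta> ^ m = 1. y / b - (\<iota> \<circ> c) \<zeta>)"
    unfolding prod_roots_of_unity[OF roots_of_unity m_pos, symmetric] C.heval_prod
    using C.hom_1 C.hom_minus by (simp add: C.heval_pCons)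
  finally have "\<exists>\<zeta>\<in>{\<zeta>. \<zeta> ^ m = 1}. y / b - (\<iota> \<circ> c) \<zeta> \<in> Q"
    by (intro Q.place_prime_prod Q.ring_diff Q.ring_const)
      (use fin binv y_in_ring in \<open>auto intro: Q.ring_mult simp: divide_inverse\<close>)
  then obtain \<zeta> where \<zeta>: "\<zeta> ^ m = 1" "y / b - (\<iota> \<circ> c) \<zeta> \<in> Q"
    by blast
  have "b * (y / b - (\<iota> \<circ> c) \<zeta>) \<in> Q"
    using \<zeta> by (intro Q.place_mult') (simp_all add: b_def Q.ring_const[unfolded comp_def])
  also have "b * (y / b - (\<iota> \<circ> c) \<zeta>) = y - (\<iota> \<circ> c) (\<beta> * \<zeta>)"
    using b0 unfolding C.hom_mult by (simp add: b_def algebra_simps)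
  finally show ?thesis
    using that \<zeta> by (simp add: Q.has_residue_def)
qed

text \<open>In \<open>y ^ m - d ^ m = (y - d) T\<close> the cofactor \<open>T\<close> has residue
  \<open>m \<gamma>^(m-1)\<close>, which is nonzero, and so is a unit at \<open>Q\<close>. The left
  side is \<open>u - d ^ m\<close>, an element of the base field, so its divisibility by
  \<open>e\<close> can be checked in K((t)) and carried over to \<open>Q\<close>.\<close>

lemma approx_y:
  assumes "\<eta> ^ m = \<rho> u" "Q.has_residue y (\<eta> $$ 0)" "\<eta> $$ 0 \<noteq> 0"
  shows "approx y \<eta>"
  unfolding approx_def
proof (intro allI impI)
  fix e :: 'a assume e: "e \<noteq> 0"
  define \<gamma> where "\<gamma> = \<eta> $$ 0"
  have \<eta>: "\<eta> \<in> fls_ring"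
    using assms mth_root_in_ring by blast
  then obtain d where d: "(\<eta> - \<rho> d) / \<rho> e \<in> fls_ring" "\<eta> - \<rho> d \<in> fls_ideal"
    using S.dense e by blast
  have "\<eta> - (\<eta> - \<rho> d) \<in> fls_ring"
    using d by (auto intro: fls_ring_closed(2)[OF \<eta>] simp only: fls_ideal_iff)
  hence dr: "\<rho> d \<in> fls_ring" "\<rho> d $$ 0 = \<gamma>"
    using d(2) by (simp_all add: fls_ideal_iff \<gamma>_def)
  define T where "T = (\<Sum>i<m. \<iota> d ^ (m - Suc i) * y ^ i)"
  have "Q.has_residue T (\<Sum>i<m. \<gamma> ^ (m - Suc i) * \<gamma> ^ i)"
    unfolding T_def using residue_lift[OF dr(1)] assms(2)
    by (intro Q.has_residue_sum Q.has_residue_mult Q.has_residue_power hom_\<iota>c)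
      (simp_all add: dr \<gamma>_def)
  also have "(\<Sum>i<m. \<gamma> ^ (m - Suc i) * \<gamma> ^ i) = (\<Sum>i<m. \<gamma> ^ (m - 1))"
    by (intro sum.cong) (auto simp flip: power_add)
  finally have T: "Q.has_residue T (of_nat m * \<gamma> ^ (m - 1))"
    by (simp only: sum_constant card_lessThan)
  have "T \<notin> Q"
    using Q.has_residue_place_iff[OF hom_\<iota>c T] m_nonzero assms(3) by (simp add: \<gamma>_def)
  hence "inverse T \<in> place_ring Q" "T \<noteq> 0"
    using Q.has_residue_ring[OF T] Q.place_0 by (auto intro: Q.unit_inverse)
  have "\<rho> ((u - d ^ m) / e) = (\<eta> ^ m - \<rho> d ^ m) / \<rho> e"
    by (simp add: S.hom_divide S.hom_diff S.hom_power assms(1))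
  also have "\<dots> = ((\<eta> - \<rho> d) / \<rho> e) * (\<Sum>i<m. \<rho> d ^ (m - Suc i) * \<eta> ^ i)"
    by (subst power_diff_sumr2) simp
  also have "\<dots> \<in> fls_ring"
    using d(1) dr \<eta> by (intro fls_ring_closed fls_ring_sum fls_ring_power)
  finally have "\<iota> ((u - d ^ m) / e) \<in> place_ring Q"
    by (rule ring_lift)
  hence "\<iota> ((u - d ^ m) / e) * inverse T \<in> place_ring Q"
    using \<open>inverse T \<in> place_ring Q\<close> by (rule Q.ring_mult)
  also have "\<iota> ((u - d ^ m) / e) * inverse T = (y ^ m - \<iota> d ^ m) / \<iota> e * inverse T"
    by (simp add: hom_divide hom_diff hom_power y_power)
  also have "\<dots> = (y - \<iota> d) / \<iota> e"
    using \<open>T \<noteq> 0\<close> by (subst power_diff_sumr2) (simp flip: T_def)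
  finally show "\<exists>d. (y - \<iota> d) / \<iota> e \<in> place_ring Q \<and> (\<eta> - \<rho> d) / \<rho> e \<in> fls_ring"
    using d by blast
qed

text \<open>The residue of \<open>y\<close> selects \<open>\<eta>\<close>; approximability passes
  from \<open>y\<close> to all polynomials in \<open>y\<close>, that is, to the whole field.
  Membership in either place is then positivity of the same order.\<close>

lemma place_above_eq: "\<exists>\<eta>\<in>conjugates. Q = fls_place (extension \<eta>)"
proof -
  obtain \<zeta> where \<zeta>: "\<zeta> ^ m = 1" "Q.has_residue y (\<beta> * \<zeta>)"
    by (rule y_residue)
  define \<eta> where "\<eta> = \<theta> * fls_const \<zeta>"
  have \<eta>: "\<eta> ^ m = \<rho> u"
    using \<zeta>(1) by (simp add: \<eta>_def power_mult_distrib \<theta>_power flip: fls_const_power)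
  have \<eta>r: "\<eta> \<in> fls_ring"
    using \<eta> mth_root_in_ring by blast
  have \<eta>0: "\<eta> $$ 0 = \<beta> * \<zeta>"
    by (simp add: \<eta>_def fls_residue_mult \<theta>_ring \<theta>_residue)
  have "\<zeta> \<noteq> 0"
    using \<zeta>(1) m_pos by (cases "\<zeta> = 0") (auto simp: power_0_left)
  hence "approx y \<eta>"
    using \<eta> \<eta>0 \<zeta>(2) \<beta>_nonzero by (intro approx_y) auto
  hence approx: "approx (heval y g) (S.heval \<eta> g)" for g
  proof (induction g)
    case 0
    show ?case
      using approx_\<iota>[of 0] by simp
  next
    case (pCons a g)
    thus ?case
      by (simp add: approx_add approx_\<iota> approx_mult y_in_ring \<eta>r)
  qed
  \<comment> \<open>So far \<open>\<eta>\<close> is only a root of \<open>X^m - u\<close>. If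
    \<open>minpoly\<close> did not vanish there, \<open>minpoly(y) = 0\<close> would be a power of
    the parameter times a unit.\<close>
  have "S.heval \<eta> minpoly = 0"
  proof (rule ccontr)
    assume "S.heval \<eta> minpoly \<noteq> 0"
    then obtain w where "w \<notin> Q" "heval y minpoly = \<iota> \<tau> powi fls_subdegree (S.heval \<eta> minpoly) * w"
      using approx_order[OF approx] by blast
    thus False
      using minpoly_root S.param_nonzero Q.place_0 by (auto simp: power_int_eq_0_iff)
  qed
  hence conj: "\<eta> \<in> conjugates"
    by (simp add: conjugates_def)
  interpret X: series_embedding "extension \<eta>" "\<iota> \<circ> c" "\<iota> \<tau>"
    using conj by (rule series_embedding_extension)
  have "z \<in> Q \<longleftrightarrow> z \<in> fls_place (extension \<eta>)" for z
  proof (cases "z = 0")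
    case True
    thus ?thesis
      using Q.place_0 by (simp add: fls_place_def fls_ideal_def)
  next
    case False
    define v where "v = extension \<eta> z"
    define k where "k = fls_subdegree v"
    have v0: "v \<noteq> 0"
      using False by (simp add: v_def)
    obtain g where g: "z = heval y g"
      using heval_surj by blast
    hence "approx z v"
      using approx[of g] conj by (simp add: v_def extension_heval)
    then obtain w where w: "w \<in> place_ring Q" "w \<notin> Q" "z = \<iota> \<tau> powi k * w"
      using approx_order v0 unfolding k_def by blast
    have "z \<in> Q \<longleftrightarrow> k > 0"
      unfolding w(3) using \<tau>_in_place w S.param_nonzero
      by (intro Q.powi_mult_unit_in_place_iff) auto
    thus ?thesis
      using v0 False by (simp add: fls_place_def fls_ideal_def k_def flip: v_def)
  qed
  hence "Q = fls_place (extension \<eta>)"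
    by (rule set_eqI)
  with conj show ?thesis
    by (rule rev_bexI)
qed

end

context kummer_place
begin

lemma places_above:
  "{Q. is_place (\<iota> \<circ> c) Q \<and> \<iota> ` fls_place \<rho> \<subseteq> Q} = (\<lambda>\<eta>. fls_place (extension \<eta>)) ` conjugates"
proof (intro equalityI subsetI)
  fix Q assume "Q \<in> {Q. is_place (\<iota> \<circ> c) Q \<and> \<iota> ` fls_place \<rho> \<subseteq> Q}"
  then interpret kummer_place_above \<rho> c \<tau> \<iota> y u m \<beta> Q
    by unfold_locales auto
  show "Q \<in> (\<lambda>\<eta>. fls_place (extension \<eta>)) ` conjugates"
    using place_above_eq by blast
next
  fix Q assume "Q \<in> (\<lambda>\<eta>. fls_place (extension \<eta>)) ` conjugates"
  then obtain \<eta> where \<eta>: "\<eta> \<in> conjugates" "Q = fls_place (extension \<eta>)"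
    by blast
  interpret X: series_embedding "extension \<eta>" "\<iota> \<circ> c" "\<iota> \<tau>"
    using \<eta>(1) by (rule series_embedding_extension)
  show "Q \<in> {Q. is_place (\<iota> \<circ> c) Q \<and> \<iota> ` fls_place \<rho> \<subseteq> Q}"
    using X.is_place_fls \<eta> by (auto simp: fls_place_def extension_\<iota>)
qed

theorem splits: "splits_completely c \<iota> (fls_place \<rho>)"
  unfolding splits_completely_def places_above
  using finite_conjugates fls_place_extension_inj
  by (simp add: card_image card_conjugates ext_degree_eq)

lemma places_above_rational:
  assumes "is_place (\<iota> \<circ> c) Q" "\<iota> ` fls_place \<rho> \<subseteq> Q"
  shows "is_rational_place (\<iota> \<circ> c) Q"
proof -
  have "Q \<in> (\<lambda>\<eta>. fls_place (extension \<eta>)) ` conjugates"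
    unfolding places_above[symmetric] using assms by simp
  then obtain \<eta> where \<eta>: "\<eta> \<in> conjugates" "Q = fls_place (extension \<eta>)"
    by blast
  interpret X: series_embedding "extension \<eta>" "\<iota> \<circ> c" "\<iota> \<tau>"
    using \<eta>(1) by (rule series_embedding_extension)
  show ?thesis
    using X.is_rational_place_fls \<eta> by simp
qed

end

section \<open>Places of the rational function field\<close>

text \<open>Transcendence keeps all denominators nonzero, so that evaluation is defined on the whole
  rational function field.\<close>

locale transcendental_point = field_embedding \<phi> for \<phi> :: "'k::field \<Rightarrow> 'b::field" +
  fixes \<xi> :: 'b
  assumes transcendental: "heval \<xi> p = 0 \<Longrightarrow> p = 0"
begin

definition rat_eval :: "'k ratfun \<Rightarrow> 'b" where
  "rat_eval z = (SOME v. \<exists>A B. B \<noteq> 0 \<and> z = Fract A B \<and> v = heval \<xi> A / heval \<xi> B)"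

lemma heval_nonzero: "p \<noteq> 0 \<Longrightarrow> heval \<xi> p \<noteq> 0"
  using transcendental by blast

lemma rat_eval_Fract:
  assumes "B \<noteq> 0"
  shows "rat_eval (Fract A B) = heval \<xi> A / heval \<xi> B"
proof -
  have "\<exists>A' B'. B' \<noteq> 0 \<and> Fract A B = Fract A' B' \<and> rat_eval (Fract A B) = heval \<xi> A' / heval \<xi> B'"
    unfolding rat_eval_def by (rule someI_ex) (use assms in blast)
  then obtain A' B' where *: "B' \<noteq> 0" "Fract A B = Fract A' B'"
    "rat_eval (Fract A B) = heval \<xi> A' / heval \<xi> B'"
    by blast
  hence "A * B' = A' * B"
    using assms by (simp add: eq_fract)
  hence "heval \<xi> A * heval \<xi> B' = heval \<xi> A' * heval \<xi> B"
    by (simp flip: heval_mult)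
  hence "heval \<xi> A' / heval \<xi> B' = heval \<xi> A / heval \<xi> B"
    using * assms by (simp add: heval_nonzero frac_eq_eq)
  thus ?thesis
    using * by simp
qed

lemma rat_eval_hom: "is_field_hom rat_eval"
  unfolding is_field_hom_def
proof (intro conjI allI)
  show "rat_eval 1 = 1"
    by (simp add: One_fract_def rat_eval_Fract)
  fix z w :: "'k ratfun"
  obtain A B A' B' where "z = Fract A B" "B \<noteq> 0" "w = Fract A' B'" "B' \<noteq> 0"
    by (metis Fract_cases)
  thus "rat_eval (z + w) = rat_eval z + rat_eval w" "rat_eval (z * w) = rat_eval z * rat_eval w"
    by (simp_all add: rat_eval_Fract heval_add heval_mult heval_nonzero field_simps)
qed

lemma rat_eval_const: "rat_eval (rf_const a) = \<phi> a"
  by (simp add: rf_const_def rat_eval_Fract)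

lemma rat_eval_x: "rat_eval rf_x = \<xi>"
  by (simp add: rf_x_def rat_eval_Fract)

end

text \<open>A relation \<open>p\<close> for the value of \<open>r\<close> is the relation
  \<open>pcompose p r\<close> for \<open>\<xi>\<close>, and composition with a nonconstant
  polynomial annihilates nothing. It turns \<open>t\<close> into \<open>a + t\<close>, and that into
  its q-th power.\<close>

lemma transcendental_point_pcompose:
  assumes "transcendental_point \<phi> \<xi>" "degree r > 0"
  shows "transcendental_point \<phi> (field_embedding.heval \<phi> \<xi> r)"
proof -
  interpret transcendental_point \<phi> \<xi>
    by fact
  show ?thesis
  proof
    fix p assume "heval (heval \<xi> r) p = 0"
    hence "pcompose p r = 0"
      by (intro transcendental) (simp add: heval_pcompose)
    thus "p = 0"
      using assms(2) by (rule pcompose_eq_0)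
  qed
qed

lemma field_embedding_fls_const: "field_embedding fls_const"
  by unfold_locales (rule is_field_hom_fls_const)

interpretation FC: field_embedding "fls_const :: 'k::field \<Rightarrow> _"
  by (rule field_embedding_fls_const)

lemma heval_fls_X: "FC.heval fls_X p = fps_to_fls (fps_of_poly p)"
  by (induction p) (simp_all add: fps_of_poly_pCons fls_times_fps_to_fls mult.commute)

lemma transcendental_fls_X: "transcendental_point fls_const (fls_X :: 'k::field fls)"
  by unfold_locales (simp add: heval_fls_X)

lemma transcendental_point_shift:
  "transcendental_point fls_const (fls_const (a :: 'k::field) + fls_X)"
  using transcendental_point_pcompose[OF transcendental_fls_X, of "[:a, 1:]"] by simp

lemma (in field_embedding) heval_inverse:
  assumes "\<xi> \<noteq> 0"
  shows "heval (inverse \<xi>) p = inverse \<xi> ^ degree p * heval \<xi> (reflect_poly p)"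
proof -
  have "map_poly \<phi> (reflect_poly p) = reflect_poly (map_poly \<phi> p)"
    by (rule poly_eqI) (simp add: coeff_map_poly coeff_reflect_poly)
  thus ?thesis
    using assms by (simp add: heval_def poly_reflect_poly_nz power_inverse)
qed

lemma transcendental_point_fls_X_inverse: "transcendental_point fls_const (inverse fls_X :: 'k::field fls)"
proof
  fix p :: "'k poly" assume "FC.heval (inverse fls_X) p = 0"
  hence "FC.heval fls_X (reflect_poly p) = 0"
    by (simp add: FC.heval_inverse)
  hence "reflect_poly p = 0"
    using transcendental_point.transcendental[OF transcendental_fls_X] by blast
  thus "p = 0"
    by simp
qed

section \<open>Expansions at the rational places\<close>

definition expand_at :: "'k::field \<Rightarrow> 'k ratfun \<Rightarrow> 'k fls" where
  "expand_at a = transcendental_point.rat_eval fls_const (fls_const a + fls_X)"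

definition expand_inf :: "'k::field ratfun \<Rightarrow> 'k fls" where
  "expand_inf = transcendental_point.rat_eval fls_const (inverse fls_X)"

lemma is_field_hom_rf_const: "is_field_hom (rf_const :: 'k::field \<Rightarrow> _)"
  by (simp add: is_field_hom_def rf_const_def One_fract_def one_pCons ac_simps)

interpretation RC: field_embedding "rf_const :: 'k::field \<Rightarrow> _"
  by unfold_locales (rule is_field_hom_rf_const)

lemma series_embedding_expand_at:
  "series_embedding (expand_at a) rf_const (rf_x - rf_const (a :: 'k::field))"
proof -
  interpret T: transcendental_point fls_const "fls_const a + fls_X"
    by (rule transcendental_point_shift)
  interpret field_embedding "expand_at a"
    unfolding expand_at_def by unfold_locales (rule T.rat_eval_hom)
  show ?thesis
    by unfold_locales (unfold hom_diff, simp_all add: expand_at_def T.rat_eval_const T.rat_eval_x)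
qed

lemma series_embedding_expand_inf:
  "series_embedding expand_inf rf_const (inverse rf_x :: 'k::field ratfun)"
proof -
  interpret T: transcendental_point fls_const "inverse fls_X :: 'k fls"
    by (rule transcendental_point_fls_X_inverse)
  interpret field_embedding "expand_inf :: _ \<Rightarrow> 'k fls"
    unfolding expand_inf_def by unfold_locales (rule T.rat_eval_hom)
  show ?thesis
    by unfold_locales (unfold hom_inverse, simp_all add: expand_inf_def T.rat_eval_const T.rat_eval_x)
qed

lemma Fract_heval: "B \<noteq> 0 \<Longrightarrow> Fract A B = RC.heval rf_x A / RC.heval rf_x B"
proof -
  have "RC.heval rf_x p = Fract p 1" for p :: "'a poly"
  proof (induction p)
    case (pCons a p)
    have "rf_const a + rf_x * Fract p 1 = Fract (pCons a p) 1"
      by (simp add: rf_const_def rf_x_def)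
    thus ?case
      by (simp add: pCons)
  qed (simp add: Zero_fract_def)
  thus "B \<noteq> 0 \<Longrightarrow> ?thesis"
    by simp
qed

lemma rf_x_nonzero: "rf_x \<noteq> 0"
  by (simp add: rf_x_def Zero_fract_def eq_fract)

text \<open>Every nonzero rational function is a power of \<open>\<tau>\<close> times an element
  that is a unit at both places. For a polynomial in \<open>\<tau>\<close>, split off the lowest
  power: what remains is a nonzero constant plus a multiple of \<open>\<tau>\<close>. Products and
  inverses keep this shape, and membership depends on the exponent only.\<close>

lemma rf_place_eqI:
  fixes P1 P2 :: "'k::field ratfun set"
  assumes "is_place rf_const P1" "is_place rf_const P2"
    and \<tau>: "\<tau> \<in> P1" "\<tau> \<in> P2" "\<tau> \<noteq> 0"
    and "(\<exists>a. rf_x = \<tau> + rf_const a) \<or> rf_x = inverse \<tau>"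
  shows "P1 = P2"
proof -
  interpret P1: function_place rf_const P1
    by unfold_locales fact
  interpret P2: function_place rf_const P2
    by unfold_locales fact
  define U where "U = (place_ring P1 - P1) \<inter> (place_ring P2 - P2)"
  define ok where "ok = (\<lambda>z. z = 0 \<or> (\<exists>k w. w \<in> U \<and> z = \<tau> powi k * w))"
  have U_mult: "w * w' \<in> U" if "w \<in> U" "w' \<in> U" for w w'
    using that by (auto simp: U_def P1.ring_mult P2.ring_mult dest: P1.place_prime P2.place_prime)
  have U_inv: "inverse w \<in> U" if "w \<in> U" for w
    using that by (auto simp: U_def P1.unit_inverse P2.unit_inverse P1.unit_inverse_not_place
        P2.unit_inverse_not_place)
  have U_const: "rf_const a \<in> U" if "a \<noteq> 0" for a
    using that by (simp add: U_def P1.const_in_place_iff[OF is_field_hom_rf_const]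
        P2.const_in_place_iff[OF is_field_hom_rf_const])
  have ok_mult: "ok (z * z')" if zz: "ok z" "ok z'" for z z'
  proof (cases "z = 0 \<or> z' = 0")
    case False
    then obtain k w k' w' where "w \<in> U" "z = \<tau> powi k * w" "w' \<in> U" "z' = \<tau> powi k' * w'"
      using zz by (auto simp: ok_def)
    hence "w * w' \<in> U" "z * z' = \<tau> powi (k + k') * (w * w')"
      using \<tau>(3) by (auto simp: U_mult power_int_add)
    thus ?thesis
      unfolding ok_def by blast
  qed (auto simp: ok_def)
  have ok_inv: "ok (inverse z)" if z: "ok z" for z
  proof (cases "z = 0")
    case False
    then obtain k w where "w \<in> U" "z = \<tau> powi k * w"
      using z by (auto simp: ok_def)
    hence "inverse w \<in> U" "inverse z = \<tau> powi (- k) * inverse w"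
      by (auto simp: U_inv power_int_minus)
    thus ?thesis
      unfolding ok_def by blast
  qed (auto simp: ok_def)
  have "\<tau> = \<tau> powi 1 * rf_const 1"
    by simp
  hence ok_\<tau>: "ok \<tau>"
    using U_const[of 1] unfolding ok_def by (metis zero_neq_one)
  have ok_heval: "ok (RC.heval \<tau> p)" for p
  proof (induction p)
    case (pCons a p)
    show ?case
    proof (cases "a = 0")
      case True
      thus ?thesis
        using pCons by (auto intro: ok_mult ok_\<tau>)
    next
      case False
      have "RC.heval \<tau> p \<in> place_ring P1" "RC.heval \<tau> p \<in> place_ring P2" for p
        by (induction p) (simp_all add: P1.ring_add P1.ring_mult P1.place_in_ring[OF \<tau>(1)]
            P2.ring_add P2.ring_mult P2.place_in_ring[OF \<tau>(2)])
      hence "\<tau> * RC.heval \<tau> p \<in> P1" "\<tau> * RC.heval \<tau> p \<in> P2"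
        using \<tau> by (auto intro: P1.place_mult P2.place_mult)
      hence "RC.heval \<tau> (pCons a p) \<in> U"
        using U_const[OF False] by (simp add: U_def P1.unit_add P2.unit_add P1.ring_add P2.ring_add
          P1.place_in_ring P2.place_in_ring)
      moreover have "RC.heval \<tau> (pCons a p) = \<tau> powi 0 * RC.heval \<tau> (pCons a p)"
        by simp
      ultimately show ?thesis
        unfolding ok_def by blast
    qed
  qed (simp add: ok_def)
  have ok_x: "ok (RC.heval rf_x p)" for p
    using assms(6)
  proof (elim disjE exE)
    fix a assume "rf_x = \<tau> + rf_const a"
    hence "RC.heval rf_x p = RC.heval \<tau> (pcompose p [:a, 1:])"
      by (simp add: RC.heval_pcompose add.commute)
    thus ?thesis
      using ok_heval by simp
  next
    assume x: "rf_x = inverse \<tau>"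
    \<comment> \<open>At the pole of \<open>x\<close>, reversing the coefficients makes a polynomial
      in \<open>x\<close> a polynomial in \<open>\<tau>\<close> up to a power of
      \<open>\<tau>\<close>.\<close>
    have "RC.heval rf_x p = inverse \<tau> ^ degree p * RC.heval \<tau> (reflect_poly p)"
      unfolding x by (rule RC.heval_inverse[OF \<tau>(3)])
    moreover have "inverse \<tau> ^ n = \<tau> powi (- int n) * rf_const 1" for n
      by (simp add: power_int_minus power_inverse)
    hence "ok (inverse \<tau> ^ degree p)"
      using U_const[of 1] unfolding ok_def by (metis zero_neq_one)
    ultimately show ?thesis
      using ok_heval ok_mult by simp
  qed
  have "z \<in> P1 \<longleftrightarrow> z \<in> P2" for z
  proof -
    obtain A B where "z = Fract A B" "B \<noteq> 0"
      by (rule Fract_cases)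
    hence "z = RC.heval rf_x A * inverse (RC.heval rf_x B)"
      by (simp add: Fract_heval divide_inverse)
    hence "ok z"
      using ok_x ok_mult ok_inv by simp
    thus ?thesis
      using \<tau> by (auto simp: ok_def U_def P1.powi_mult_unit_in_place_iff P2.powi_mult_unit_in_place_iff)
  qed
  thus ?thesis
    by (rule set_eqI)
qed

lemma inverse_x_in_place_iff: "inverse rf_x \<in> P \<longleftrightarrow> rf_x \<notin> place_ring P"
  by (simp add: place_ring_def rf_x_nonzero)

lemma P_inf_eqI:
  fixes P :: "'k::field ratfun set"
  assumes "is_place rf_const P" "rf_x \<notin> place_ring P"
  shows "P = fls_place expand_inf"
proof (rule rf_place_eqI)
  interpret S: series_embedding expand_inf rf_const "inverse rf_x :: 'k ratfun"
    by (rule series_embedding_expand_inf)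
  show "is_place rf_const (fls_place (expand_inf :: 'k ratfun \<Rightarrow> _))"
    by (rule S.is_place_fls)
  show "inverse rf_x \<in> fls_place (expand_inf :: 'k ratfun \<Rightarrow> _)"
    using fls_X_in_ideal by (simp only: fls_place_def mem_Collect_eq S.param)
qed (use assms in \<open>auto simp: inverse_x_in_place_iff rf_x_nonzero\<close>)

lemma P_inf_eq: "P_inf = fls_place (expand_inf :: 'k::field ratfun \<Rightarrow> _)"
  unfolding P_inf_def
proof (rule the_equality)
  interpret S: series_embedding expand_inf rf_const "inverse rf_x :: 'k ratfun"
    by (rule series_embedding_expand_inf)
  have "inverse rf_x \<in> fls_place (expand_inf :: 'k ratfun \<Rightarrow> _)"
    using fls_X_in_ideal by (simp only: fls_place_def mem_Collect_eq S.param)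
  thus "is_place rf_const (fls_place (expand_inf :: 'k ratfun \<Rightarrow> _)) \<and>
    rf_x \<notin> place_ring (fls_place (expand_inf :: 'k ratfun \<Rightarrow> _))"
    using S.is_place_fls by (simp add: inverse_x_in_place_iff)
qed (use P_inf_eqI in blast)

text \<open>The single basis element \<open>b\<close> need not be a constant. Expanding
  \<open>1\<close> in it shows that \<open>b\<close> is congruent to \<open>1 / s\<close>, so
  \<open>z\<close>, congruent to \<open>r b\<close>, has residue \<open>r / s\<close>.\<close>

lemma (in function_place) rational_residue:
  assumes "is_field_hom c" "is_rational_place c P" "z \<in> place_ring P"
  shows "\<exists>a. has_residue z a"
proof -
  interpret C: field_embedding c
    by unfold_locales fact
  obtain B where "residue_basis c P B" "card B = 1"
    using assms by (auto simp: is_rational_place_def has_place_degree_def)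
  then obtain b where b: "b \<in> place_ring P"
    and ex: "\<And>z. z \<in> place_ring P \<Longrightarrow> \<exists>s. z - c s * b \<in> P"
    by (auto simp: residue_basis_def card_1_singleton_iff) metis
  obtain s where s: "1 - c s * b \<in> P"
    using ex[of 1] by auto
  obtain r where r: "z - c r * b \<in> P"
    using ex assms by blast
  have "s \<noteq> 0"
    using s by auto
  have "(z - c r * b) - c (r / s) * (1 - c s * b) \<in> P"
    by (rule place_diff[OF r place_mult'[OF ring_const s]])
  also have "(z - c r * b) - c (r / s) * (1 - c s * b) = z - c (r / s)"
    using \<open>s \<noteq> 0\<close> by (simp add: C.hom_divide field_simps)
  finally show ?thesis
    by (auto simp: has_residue_def)
qed

lemma rational_place_cases:
  assumes "is_rational_place rf_const P" "P \<noteq> P_inf"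
  obtains a where "P = fls_place (expand_at a)"
proof -
  have P: "is_place rf_const P"
    using assms by (simp add: is_rational_place_def)
  interpret function_place rf_const P
    by unfold_locales (rule P)
  have "rf_x \<in> place_ring P"
    using P_inf_eqI[OF P] assms(2) P_inf_eq by blast
  then obtain a where a: "rf_x - rf_const a \<in> P"
    using rational_residue is_field_hom_rf_const assms(1) by (auto simp: has_residue_def)
  interpret S: series_embedding "expand_at a" rf_const "rf_x - rf_const a"
    by (rule series_embedding_expand_at)
  have "P = fls_place (expand_at a)"
  proof (rule rf_place_eqI[OF P S.is_place_fls a])
    show "rf_x - rf_const a \<in> fls_place (expand_at a)"
      using fls_X_in_ideal by (simp only: fls_place_def mem_Collect_eq S.param)
    show "rf_x - rf_const a \<noteq> 0"
      by (rule S.param_nonzero)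
    show "(\<exists>b. rf_x = rf_x - rf_const a + rf_const b) \<or> rf_x = inverse (rf_x - rf_const a)"
      by (intro disjI1 exI[of _ a]) simp
  qed
  thus ?thesis
    using that by blast
qed

text \<open>Any generator of the place has order exactly 1 in the series: at least 1 as an element
  of the place, at most 1 because it divides \<open>\<tau>\<close>. Hence the exponent does not
  depend on the generator.\<close>

lemma (in series_embedding) place_val_fls:
  assumes "z \<noteq> 0"
  shows "place_val (fls_place \<rho>) z = fls_subdegree (\<rho> z)"
  unfolding place_val_def place_ring_fls
proof (rule the_equality)
  have div_unit: "fls_subdegree (\<rho> w) = 0 \<and> w \<noteq> 0 \<longleftrightarrow> w \<in> {z. \<rho> z \<in> fls_ring} - fls_place \<rho>" for w
    by (auto simp: fls_place_def fls_ring_def fls_ideal_def)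
  define k where "k = fls_subdegree (\<rho> z)"
  have "fls_place \<rho> = (*) \<tau> ` {z. \<rho> z \<in> fls_ring}"
  proof (intro equalityI subsetI)
    fix w assume "w \<in> fls_place \<rho>"
    hence "\<rho> w / \<rho> \<tau> \<in> fls_ring"
      using param_nonzero by (subst fls_divide_in_ring_iff) (auto simp: fls_place_def fls_ideal_def)
    hence "\<rho> (w / \<tau>) \<in> fls_ring"
      by (simp only: hom_divide)
    moreover have "w = \<tau> * (w / \<tau>)"
      using param_nonzero by simp
    ultimately show "w \<in> (*) \<tau> ` {z. \<rho> z \<in> fls_ring}"
      by blast
  next
    fix w assume "w \<in> (*) \<tau> ` {z. \<rho> z \<in> fls_ring}"
    thus "w \<in> fls_place \<rho>"
      by (auto simp: fls_place_def fls_ideal_def hom_mult fls_ring_def)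
  qed
  moreover have "z / \<tau> powi k \<in> {z. \<rho> z \<in> fls_ring} - fls_place \<rho>"
  proof -
    have "fls_subdegree (\<rho> (z / \<tau> powi k)) = 0"
      unfolding hom_divide hom_power_int using assms by (simp add: fls_divide_subdegree k_def)
    thus ?thesis
      using assms param_nonzero by (subst div_unit[symmetric]) simp
  qed
  moreover have "z = \<tau> powi k * (z / \<tau> powi k)"
    using param_nonzero by simp
  ultimately show "\<exists>t u. fls_place \<rho> = (*) t ` {z. \<rho> z \<in> fls_ring} \<and>
      u \<in> {z. \<rho> z \<in> fls_ring} - fls_place \<rho> \<and> z = t powi k * u"
    by blast
  fix j assume "\<exists>t u. fls_place \<rho> = (*) t ` {z. \<rho> z \<in> fls_ring} \<and>
      u \<in> {z. \<rho> z \<in> fls_ring} - fls_place \<rho> \<and> z = t powi j * u"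
  then obtain t u where t: "fls_place \<rho> = (*) t ` {z. \<rho> z \<in> fls_ring}"
    and u: "fls_subdegree (\<rho> u) = 0" "u \<noteq> 0" and z: "z = t powi j * u"
    unfolding div_unit[symmetric] by blast
  have "\<tau> \<in> fls_place \<rho>"
    by (simp add: fls_place_def fls_X_in_ideal)
  then obtain r where r: "\<rho> r \<in> fls_ring" "\<tau> = t * r"
    using t by blast
  have t0: "t \<noteq> 0" "r \<noteq> 0"
    using r param_nonzero by auto
  have "t * 1 \<in> fls_place \<rho>"
    unfolding t by (rule imageI) simp
  hence "fls_subdegree (\<rho> t) \<ge> 1"
    using t0 by (auto simp: fls_place_def fls_ideal_def)
  moreover have "fls_subdegree (\<rho> \<tau>) = fls_subdegree (\<rho> t) + fls_subdegree (\<rho> r)"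
    using t0 unfolding r hom_mult by simp
  moreover have "fls_subdegree (\<rho> r) \<ge> 0"
    using r by (simp add: fls_ring_def)
  ultimately have "fls_subdegree (\<rho> t) = 1"
    by simp
  thus "j = fls_subdegree (\<rho> z)"
    unfolding z hom_mult hom_power_int using t0 u by simp
qed

section \<open>Values of quasi-symmetric functions\<close>

definition is_ring_hom :: "('a::comm_ring_1 \<Rightarrow> 'b::comm_ring_1) \<Rightarrow> bool" where
  "is_ring_hom \<psi> \<longleftrightarrow> \<psi> 0 = 0 \<and> \<psi> 1 = 1 \<and> (\<forall>x y. \<psi> (x + y) = \<psi> x + \<psi> y) \<and>
     (\<forall>x y. \<psi> (x * y) = \<psi> x * \<psi> y)"

lemma is_ring_hom_field: "is_field_hom \<phi> \<Longrightarrow> is_ring_hom \<phi>"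
  using field_embedding.hom_0[OF field_embedding.intro] by (auto simp: is_ring_hom_def is_field_hom_def)

lemma ring_hom_power: "is_ring_hom \<psi> \<Longrightarrow> \<psi> (x ^ n) = \<psi> x ^ n"
  by (induction n) (auto simp: is_ring_hom_def)

lemma ring_hom_sum: "is_ring_hom \<psi> \<Longrightarrow> \<psi> (sum f A) = (\<Sum>i\<in>A. \<psi> (f i))"
  by (induction A rule: infinite_finite_induct) (auto simp: is_ring_hom_def)

lemma ring_hom_prod: "is_ring_hom \<psi> \<Longrightarrow> \<psi> (prod f A) = (\<Prod>i\<in>A. \<psi> (f i))"
  by (induction A rule: infinite_finite_induct) (auto simp: is_ring_hom_def)

lemma poly_mapping_eq_sum_single:
  "p = (\<Sum>m\<in>Poly_Mapping.keys p. Poly_Mapping.single m (Poly_Mapping.lookup p m))"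
proof (rule poly_mapping_eqI)
  fix k
  have "Poly_Mapping.lookup (\<Sum>m\<in>Poly_Mapping.keys p. Poly_Mapping.single m (Poly_Mapping.lookup p m)) k =
    (\<Sum>m\<in>Poly_Mapping.keys p. if m = k then Poly_Mapping.lookup p m else 0)"
    by (simp add: lookup_sum lookup_single when_def)
  also have "\<dots> = Poly_Mapping.lookup p k"
    by (simp add: in_keys_iff)
  finally show "Poly_Mapping.lookup p k = Poly_Mapping.lookup
    (\<Sum>m\<in>Poly_Mapping.keys p. Poly_Mapping.single m (Poly_Mapping.lookup p m)) k" ..
qed

definition monomial_eval :: "(nat \<Rightarrow> 'b::comm_ring_1) \<Rightarrow> (nat \<Rightarrow>\<^sub>0 nat) \<Rightarrow> 'b" where
  "monomial_eval b m = (\<Prod>i\<in>Poly_Mapping.keys m. b i ^ Poly_Mapping.lookup m i)"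

lemma monomial_eval_superset:
  assumes "finite A" "Poly_Mapping.keys m \<subseteq> A"
  shows "monomial_eval b m = (\<Prod>i\<in>A. b i ^ Poly_Mapping.lookup m i)"
  unfolding monomial_eval_def using assms by (intro prod.mono_neutral_left) (auto simp: in_keys_iff)

lemma monomial_eval_add: "monomial_eval b (m + m') = monomial_eval b m * monomial_eval b m'"
proof -
  define A where "A = Poly_Mapping.keys m \<union> Poly_Mapping.keys m'"
  have "finite A" "Poly_Mapping.keys m \<subseteq> A" "Poly_Mapping.keys m' \<subseteq> A" "Poly_Mapping.keys (m + m') \<subseteq> A"
    using keys_add[of m m'] by (auto simp: A_def)
  thus ?thesis
    by (simp add: monomial_eval_superset lookup_add power_add prod.distrib)
qed

context
  fixes \<phi> :: "'k::field \<Rightarrow> 'b::comm_ring_1"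
  assumes \<phi>: "is_ring_hom \<phi>"
begin

lemma mpol_eval_superset:
  assumes "finite A" "Poly_Mapping.keys p \<subseteq> A"
  shows "mpol_eval \<phi> b p = (\<Sum>m\<in>A. \<phi> (Poly_Mapping.lookup p m) * monomial_eval b m)"
  unfolding mpol_eval_def monomial_eval_def
  using assms \<phi> by (intro sum.mono_neutral_left) (auto simp: in_keys_iff is_ring_hom_def)

lemma mpol_eval_add: "mpol_eval \<phi> b (p + r) = mpol_eval \<phi> b p + mpol_eval \<phi> b r"
proof -
  define A where "A = Poly_Mapping.keys p \<union> Poly_Mapping.keys r"
  have "finite A" "Poly_Mapping.keys p \<subseteq> A" "Poly_Mapping.keys r \<subseteq> A" "Poly_Mapping.keys (p + r) \<subseteq> A"
    using keys_add[of p r] by (auto simp: A_def)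
  moreover have "\<phi> (x + y) = \<phi> x + \<phi> y" for x y
    using \<phi> by (simp add: is_ring_hom_def)
  ultimately show ?thesis
    by (simp add: mpol_eval_superset lookup_add sum.distrib distrib_right)
qed

lemma mpol_eval_single: "mpol_eval \<phi> b (Poly_Mapping.single m a) = \<phi> a * monomial_eval b m"
  by (subst mpol_eval_superset[of "{m}"]) auto

lemma mpol_eval_0: "mpol_eval \<phi> b 0 = 0"
  by (simp add: mpol_eval_def)

lemma mpol_eval_sum: "mpol_eval \<phi> b (sum f A) = (\<Sum>i\<in>A. mpol_eval \<phi> b (f i))"
  by (induction A rule: infinite_finite_induct) (simp_all add: mpol_eval_0 mpol_eval_add)

lemma mpol_eval_mult: "mpol_eval \<phi> b (p * r) = mpol_eval \<phi> b p * mpol_eval \<phi> b r"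
proof -
  have "mpol_eval \<phi> b (p * r) = mpol_eval \<phi> b
    ((\<Sum>m\<in>Poly_Mapping.keys p. Poly_Mapping.single m (Poly_Mapping.lookup p m)) *
     (\<Sum>m\<in>Poly_Mapping.keys r. Poly_Mapping.single m (Poly_Mapping.lookup r m)))"
    by (simp flip: poly_mapping_eq_sum_single)
  also have "\<dots> = (\<Sum>m\<in>Poly_Mapping.keys p. \<phi> (Poly_Mapping.lookup p m) * monomial_eval b m) *
    (\<Sum>m\<in>Poly_Mapping.keys r. \<phi> (Poly_Mapping.lookup r m) * monomial_eval b m)"
    using \<phi> by (simp add: sum_product mult_single mpol_eval_sum mpol_eval_single monomial_eval_add
      is_ring_hom_def mult_ac)
  finally show ?thesis
    by (simp only: mpol_eval_superset[OF finite_keys subset_refl])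
qed

lemma mpol_eval_is_hom: "is_ring_hom (mpol_eval \<phi> b)"
proof -
  have "monomial_eval b 0 = 1"
    by (simp add: monomial_eval_def)
  hence "mpol_eval \<phi> b 1 = 1"
    using mpol_eval_single[of b 0 1] \<phi> by (simp add: is_ring_hom_def)
  thus ?thesis
    by (simp add: is_ring_hom_def mpol_eval_0 mpol_eval_add mpol_eval_mult)
qed

lemma mpol_eval_const: "mpol_eval \<phi> b (Poly_Mapping.single 0 a) = \<phi> a"
  by (simp add: mpol_eval_single monomial_eval_def)

lemma mpol_eval_var: "mpol_eval \<phi> b (Poly_Mapping.single (Poly_Mapping.single i 1) 1) = b i"
  using \<phi> by (simp add: mpol_eval_single monomial_eval_def is_ring_hom_def)

lemma hom_mpol_eval:
  assumes "is_ring_hom \<psi>"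
  shows "\<psi> (mpol_eval \<phi> b p) = mpol_eval (\<lambda>a. \<psi> (\<phi> a)) (\<lambda>i. \<psi> (b i)) p"
proof -
  have "\<psi> (x * y) = \<psi> x * \<psi> y" for x y
    using assms by (simp add: is_ring_hom_def)
  thus ?thesis
    by (simp add: mpol_eval_def ring_hom_sum[OF assms] ring_hom_prod[OF assms] ring_hom_power[OF assms])
qed

end

lemma mpol_eval_cong:
  assumes "in_first_vars n p" "\<And>i. i < n \<Longrightarrow> b i = b' i"
  shows "mpol_eval \<phi> b p = mpol_eval \<phi> b' p"
  unfolding mpol_eval_def
proof (intro sum.cong prod.cong refl arg_cong2[where f = "(*)"])
  fix m i assume "m \<in> Poly_Mapping.keys p" "i \<in> Poly_Mapping.keys m"
  hence "i < n"
    using assms(1) by (auto simp: in_first_vars_def)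
  thus "b i ^ Poly_Mapping.lookup m i = b' i ^ Poly_Mapping.lookup m i"
    using assms(2) by simp
qed

text \<open>Cross-multiplying two representations gives an identity of polynomials, which evaluation
  preserves; so the value is independent of the representation.\<close>

lemma mrat_eval_eq:
  assumes "is_field_hom \<phi>" "mrat_rep n f N D" "mpol_eval \<phi> b D \<noteq> 0"
  shows "mrat_eval n \<phi> b f = mpol_eval \<phi> b N / mpol_eval \<phi> b D"
  unfolding mrat_eval_def
proof (rule the_equality)
  show "\<exists>N' D'. mrat_rep n f N' D' \<and> mpol_eval \<phi> b D' \<noteq> 0 \<and>
    mpol_eval \<phi> b N / mpol_eval \<phi> b D = mpol_eval \<phi> b N' / mpol_eval \<phi> b D'"
    using assms by blast
  fix v assume "\<exists>N' D'. mrat_rep n f N' D' \<and> mpol_eval \<phi> b D' \<noteq> 0 \<and>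
    v = mpol_eval \<phi> b N' / mpol_eval \<phi> b D'"
  then obtain N' D' where *: "mrat_rep n f N' D'" "mpol_eval \<phi> b D' \<noteq> 0"
    "v = mpol_eval \<phi> b N' / mpol_eval \<phi> b D'"
    by blast
  have "N * D' = N' * D"
    using assms * by (auto simp: mrat_rep_def eq_fract)
  hence "mpol_eval \<phi> b N * mpol_eval \<phi> b D' = mpol_eval \<phi> b N' * mpol_eval \<phi> b D"
    using assms by (simp add: is_ring_hom_field flip: mpol_eval_mult)
  thus "v = mpol_eval \<phi> b N / mpol_eval \<phi> b D"
    using * assms by (simp add: frac_eq_eq)
qed

lemma is_ring_hom_single: "is_ring_hom (Poly_Mapping.single 0 :: 'k::field \<Rightarrow> 'k mpol)"
  by (simp add: is_ring_hom_def single_add mult_single)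

lemma is_field_hom_mrat_const: "is_field_hom (mrat_const :: 'k::field \<Rightarrow> _)"
  by (simp add: is_field_hom_def mrat_const_def single_add mult_single One_fract_def)

lemma is_ring_hom_Fract: "is_ring_hom (\<lambda>p. Fract p 1)"
  by (simp add: is_ring_hom_def Zero_fract_def One_fract_def)

text \<open>Quasi-symmetry is a formal identity; a polynomial with renamed variables has at
  \<open>b\<close> the value that the original has at the rotated point. Two representations are
  needed, as a denominator that is nonzero at one of the points may vanish at the other.\<close>

lemma mrat_eval_rotate:
  assumes qs: "quasi_symmetric n f" and \<phi>: "is_field_hom \<phi>"
    and def: "mrat_defined n \<phi> b f" "mrat_defined n \<phi> (\<lambda>i. b (Suc i mod n)) f"
  shows "mrat_eval n \<phi> (\<lambda>i. b (Suc i mod n)) f = mrat_eval n \<phi> b f"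
proof -
  obtain N D where ND: "mrat_rep n f N D" "mpol_eval \<phi> b D \<noteq> 0"
    using def by (auto simp: mrat_defined_def)
  obtain N1 D1 where ND1: "mrat_rep n f N1 D1" "mpol_eval \<phi> (\<lambda>i. b (Suc i mod n)) D1 \<noteq> 0"
    using def by (auto simp: mrat_defined_def)
  define rot :: "'a mpol \<Rightarrow> 'a mpol" where
    "rot = mpol_eval (Poly_Mapping.single 0) (\<lambda>i. Poly_Mapping.single (Poly_Mapping.single (Suc i mod n) 1) 1)"
  note hom = is_ring_hom_field[OF \<phi>]
  have rot: "mpol_eval \<phi> b (rot p) = mpol_eval \<phi> (\<lambda>i. b (Suc i mod n)) p" for p
    unfolding rot_def hom_mpol_eval[OF is_ring_hom_single mpol_eval_is_hom[OF hom]]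
    unfolding mpol_eval_const[OF hom] mpol_eval_var[OF hom] ..
  have rot': "mpol_eval mrat_const (\<lambda>i. mrat_var (Suc i mod n)) p = Fract (rot p) 1" for p
    unfolding rot_def hom_mpol_eval[OF is_ring_hom_single is_ring_hom_Fract]
    unfolding mrat_const_def[abs_def] mrat_var_def ..
  have "mpol_eval \<phi> b (rot D1) \<noteq> 0"
    using ND1(2) by (simp add: rot)
  hence nz: "rot D1 \<noteq> 0"
    using hom by (auto simp: mpol_eval_0)
  have "f = mrat_eval n mrat_const (\<lambda>i. mrat_var (Suc i mod n)) f"
    using qs by (simp add: quasi_symmetric_def)
  also have "\<dots> = Fract (rot N1) 1 / Fract (rot D1) 1"
    using nz by (subst mrat_eval_eq[OF is_field_hom_mrat_const ND1(1)])
      (simp_all add: rot' Zero_fract_def eq_fract)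
  also have "\<dots> = Fract (rot N1) (rot D1)"
    by simp
  finally have "Fract N D = Fract (rot N1) (rot D1)"
    using ND by (simp add: mrat_rep_def)
  hence "N * rot D1 = rot N1 * D"
    using nz ND by (simp add: eq_fract mrat_rep_def)
  hence "mpol_eval \<phi> b N * mpol_eval \<phi> b (rot D1) = mpol_eval \<phi> b (rot N1) * mpol_eval \<phi> b D"
    using hom by (simp flip: mpol_eval_mult)
  thus ?thesis
    using ND ND1 by (simp add: mrat_eval_eq[OF \<phi> ND] mrat_eval_eq[OF \<phi> ND1] rot frac_eq_eq)
qed

lemma fls_divide_residue:
  assumes "v \<in> fls_ring" "w \<in> fls_ring" "w $$ 0 \<noteq> 0"
  shows "v / w \<in> fls_ring" "(v / w) $$ 0 = v $$ 0 / w $$ 0"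
proof -
  have w: "w \<noteq> 0" "fls_subdegree w = 0"
    using assms fls_subdegree_leI[of w 0] by (auto simp: fls_ring_def)
  show r: "v / w \<in> fls_ring"
    unfolding fls_divide_in_ring_iff[OF w(1)] using assms w by (simp add: fls_ring_def)
  have "(v / w * w) $$ 0 = (v / w) $$ 0 * w $$ 0"
    using r assms(2) by (rule fls_residue_mult)
  thus "(v / w) $$ 0 = v $$ 0 / w $$ 0"
    using w assms(3) by (simp add: field_simps)
qed

lemma is_field_hom_id: "is_field_hom (\<lambda>a. a)"
  by (simp add: is_field_hom_def)

text \<open>The denominator is chosen nonzero at \<open>(b, b^q, ...)\<close>, so at the series
  \<open>\<eta>\<close> it becomes a power series with nonzero constant coefficient, and taking
  residues commutes with the division. A general \<open>\<eta>\<close> is allowed in order to cover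
  both \<open>a + t\<close> and its q-th power.\<close>

lemma qs_residue:
  fixes \<rho> :: "'k::field ratfun \<Rightarrow> 'k fls"
  assumes \<rho>: "is_field_hom \<rho>" "\<And>a. \<rho> (rf_const a) = fls_const a" "\<rho> rf_x = \<eta>"
    and \<eta>: "\<eta> \<in> fls_ring" "\<eta> $$ 0 = b"
    and f: "qs_represents n q f w" "mrat_defined n (\<lambda>a. a) (\<lambda>i. b ^ (q ^ i)) f"
  shows "\<rho> w \<in> fls_ring" "\<rho> w $$ 0 = mrat_eval n (\<lambda>a. a) (\<lambda>i. b ^ (q ^ i)) f"
proof -
  obtain N D where ND: "mrat_rep n f N D" "mpol_eval (\<lambda>a. a) (\<lambda>i. b ^ (q ^ i)) D \<noteq> 0"
    using f by (auto simp: mrat_defined_def)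
  obtain e where e: "\<eta> = fps_to_fls e"
    using \<eta> by (auto simp: fls_ring_iff)
  have homs: "is_ring_hom (fps_const :: 'k \<Rightarrow> _)" "is_ring_hom (fps_to_fls :: 'k fps \<Rightarrow> _)"
    "is_ring_hom (\<lambda>s :: 'k fps. s $ 0)" "is_ring_hom \<rho>" "is_ring_hom (rf_const :: 'k \<Rightarrow> _)"
    by (simp_all add: is_ring_hom_field[OF \<rho>(1)] is_ring_hom_field[OF is_field_hom_rf_const])
      (simp_all add: is_ring_hom_def fls_times_fps_to_fls)
  define ev where "ev = mpol_eval fps_const (\<lambda>i. e ^ (q ^ i))"
  have ev: "\<rho> (mpol_eval rf_const (\<lambda>i. rf_x ^ (q ^ i)) p) = fps_to_fls (ev p)" for p
    unfolding ev_def hom_mpol_eval[OF homs(5,4)] hom_mpol_eval[OF homs(1,2)]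
      ring_hom_power[OF homs(4)] \<rho> e fps_to_fls_power by simp
  have ev0: "ev p $ 0 = mpol_eval (\<lambda>a. a) (\<lambda>i. b ^ (q ^ i)) p" for p
    unfolding ev_def hom_mpol_eval[OF homs(1,3)] using \<eta> e by (simp add: fps_nth_power_0)
  have "fps_to_fls (ev D) \<noteq> 0"
    using ND(2) ev0[of D] by auto
  hence "mpol_eval rf_const (\<lambda>i. rf_x ^ (q ^ i)) D \<noteq> 0"
    using ev[of D] homs(4) by (auto simp: is_ring_hom_def)
  hence "w = mpol_eval rf_const (\<lambda>i. rf_x ^ (q ^ i)) N / mpol_eval rf_const (\<lambda>i. rf_x ^ (q ^ i)) D"
    using f(1) mrat_eval_eq[OF is_field_hom_rf_const ND(1)] by (simp add: qs_represents_def)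
  hence w: "\<rho> w = fps_to_fls (ev N) / fps_to_fls (ev D)"
    using \<rho>(1) by (simp add: field_embedding.hom_divide[OF field_embedding.intro] ev)
  show "\<rho> w \<in> fls_ring" "\<rho> w $$ 0 = mrat_eval n (\<lambda>a. a) (\<lambda>i. b ^ (q ^ i)) f"
    unfolding w mrat_eval_eq[OF is_field_hom_id ND]
    using fls_divide_residue[of "fps_to_fls (ev N)" "fps_to_fls (ev D)"] ND(2)
    by (simp_all add: ev0)
qed

text \<open>The q-th power map is additive in this characteristic and fixes the
  coefficients.\<close>

lemma heval_power_char:
  assumes "q = CHAR('k::finite_field) ^ s" "\<forall>i. coeff A i \<in> Fq q"
  shows "FC.heval (\<xi> ^ q) A = FC.heval \<xi> (A :: 'k poly) ^ q"
  using assms(2)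
proof (induction A)
  case 0
  have "q > 0"
    using assms by simp
  thus ?case
    by simp
next
  case (pCons a A)
  have "a ^ q = a"
    using pCons.prems by (auto simp: Fq_def coeff_pCons split: nat.splits dest: spec[of _ 0])
  moreover have "\<forall>i. coeff A i \<in> Fq q"
    using pCons.prems by (metis coeff_pCons_Suc)
  ultimately show ?case
    using pCons.IH assms(1) freshmans_dream'[of q s "fls_const a" "\<xi> * FC.heval \<xi> A"]
    by (simp add: power_mult_distrib flip: fls_const_power)
qed

text \<open>The residue of \<open>w\<close> after substituting \<open>(a + t)^q\<close> is computed
  twice: the univariate fraction gives the q-th power of the residue at \<open>a\<close>, the
  multivariate function gives the residue at \<open>a\<close> itself, through the cyclic
  shift.\<close>

lemma qs_residue_in_Fq:
  fixes a :: "'k::finite_field"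
  assumes card: "CARD('k) = q ^ n" and n: "n > 0" and q: "q = CHAR('k) ^ s"
    and "w \<in> F_qs_phi n q" "qs_no_zeros n q w"
  shows "expand_at a w \<in> fls_ring" "expand_at a w $$ 0 \<noteq> 0" "expand_at a w $$ 0 \<in> Fq q"
proof -
  obtain f where f: "qs_represents n q f w"
    "\<And>b. mrat_defined n (\<lambda>c. c) (\<lambda>i. b ^ (q ^ i)) f"
    "\<And>b. mrat_eval n (\<lambda>c. c) (\<lambda>i. b ^ (q ^ i)) f \<noteq> 0"
    using assms by (auto simp: qs_no_zeros_def)
  obtain A B where AB: "B \<noteq> 0" "w = Fract A B" "\<forall>i. coeff A i \<in> Fq q" "\<forall>i. coeff B i \<in> Fq q"
    using assms by (auto simp: F_qs_phi_def)
  define \<xi> where "\<xi> = fls_const a + fls_X"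
  have \<xi>: "\<xi> \<in> fls_ring" "\<xi> $$ 0 = a"
    unfolding \<xi>_def by (intro fls_ring_closed) (simp_all add: fls_ring_def)
  have q0: "q > 0"
    using q by simp
  interpret T: transcendental_point fls_const \<xi>
    unfolding \<xi>_def by (rule transcendental_point_shift)
  \<comment> \<open>Since \<open>(a + t)^q\<close> is no uniformizer up to a constant unless
    \<open>q = 1\<close>, this is an embedding but no expansion at a place; its residues are still
    values at \<open>a ^ q\<close>.\<close>
  interpret T': transcendental_point fls_const "\<xi> ^ q"
    using transcendental_point_pcompose[OF T.transcendental_point_axioms, of "monom 1 q"] q0
    by (simp add: degree_monom_eq FC.heval_monom)
  have ex: "expand_at a = T.rat_eval"
    by (simp add: expand_at_def \<xi>_def)
  note r = qs_residue[OF T.rat_eval_hom T.rat_eval_const T.rat_eval_x \<xi> f(1,2)]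
  note r' = qs_residue[OF T'.rat_eval_hom T'.rat_eval_const T'.rat_eval_x _ _ f(1,2), of "a ^ q"]
  show "expand_at a w \<in> fls_ring" "expand_at a w $$ 0 \<noteq> 0"
    using r f(3) by (simp_all add: ex)
  obtain N D where ND: "mrat_rep n f N D" "mpol_eval (\<lambda>c. c) (\<lambda>i. (a ^ q) ^ (q ^ i)) D \<noteq> 0"
    using f(2)[of "a ^ q"] by (auto simp: mrat_defined_def)
  hence in_vars: "in_first_vars n N" "in_first_vars n D"
    by (auto simp: mrat_rep_def)
  \<comment> \<open>The index wraps around only for \<open>i = n - 1\<close>, where
    \<open>a ^ (q ^ n) = a\<close> closes the cycle.\<close>
  have "(a ^ q) ^ (q ^ i) = a ^ (q ^ (Suc i mod n))" if "i < n" for i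
  proof (cases "Suc i = n")
    case True
    thus ?thesis
      using finite_field_power_card_eq_same[of a] card by (auto simp flip: power_mult power_Suc)
  qed (use that in \<open>simp flip: power_mult\<close>)
  hence cong: "mpol_eval (\<lambda>c. c) (\<lambda>i. (a ^ q) ^ (q ^ i)) p =
    mpol_eval (\<lambda>c. c) (\<lambda>i. a ^ (q ^ (Suc i mod n))) p" if "in_first_vars n p" for p :: "'k mpol"
    using that by (intro mpol_eval_cong[OF that])
  have D: "mpol_eval (\<lambda>c. c) (\<lambda>i. a ^ (q ^ (Suc i mod n))) D \<noteq> 0"
    using ND(2) by (simp add: cong in_vars)
  have "T'.rat_eval w = T.rat_eval w ^ q"
    using AB by (simp add: T'.rat_eval_Fract T.rat_eval_Fract heval_power_char[OF q] power_divide)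
  hence "(T.rat_eval w $$ 0) ^ q = T'.rat_eval w $$ 0"
    using r(1) by (simp add: fls_residue_power)
  also have "\<dots> = mrat_eval n (\<lambda>c. c) (\<lambda>i. (a ^ q) ^ (q ^ i)) f"
    using \<xi> by (intro r'(2)) (auto simp: fls_ring_power fls_residue_power)
  also have "\<dots> = mpol_eval (\<lambda>c. c) (\<lambda>i. a ^ (q ^ (Suc i mod n))) N /
      mpol_eval (\<lambda>c. c) (\<lambda>i. a ^ (q ^ (Suc i mod n))) D"
    using ND by (simp add: mrat_eval_eq[OF is_field_hom_id ND(1)] cong in_vars)
  also have "\<dots> = mrat_eval n (\<lambda>c. c) (\<lambda>i. a ^ (q ^ (Suc i mod n))) f"
    using D by (simp add: mrat_eval_eq[OF is_field_hom_id ND(1)])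
  also have "\<dots> = mrat_eval n (\<lambda>c. c) (\<lambda>i. a ^ (q ^ i)) f"
    using f(1,2) ND(1) D
    by (intro mrat_eval_rotate is_field_hom_id) (auto simp: qs_represents_def mrat_defined_def)
  also have "\<dots> = T.rat_eval w $$ 0"
    using r by simp
  finally show "expand_at a w $$ 0 \<in> Fq q"
    by (simp add: ex Fq_def)
qed

section \<open>Power residues in a finite field\<close>

lemma card_power_eq_le:
  fixes c :: "'a::idom"
  assumes "m > 0"
  shows "finite {x. x ^ m = c}" "card {x. x ^ m = c} \<le> m"
proof -
  define p where "p = monom 1 m - [:c:]"
  have "coeff p m = 1"
    using assms by (simp add: p_def coeff_pCons split: nat.splits)
  hence p: "p \<noteq> 0"
    by auto
  have "degree p \<le> m"
    unfolding p_def by (intro degree_diff_le) (auto simp: degree_monom_le)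
  moreover have "{x. x ^ m = c} = {x. poly p x = 0}"
    by (simp add: p_def poly_monom)
  ultimately show "finite {x. x ^ m = c}" "card {x. x ^ m = c} \<le> m"
    using poly_roots_finite[OF p] card_poly_roots_bound[OF p] by auto
qed

text \<open>
  The \<open>m\<close>-th powers of the \<open>m d\<close> units are among the at most \<open>d\<close> roots of \<open>X\<^sup>d - 1\<close>, and each is
  taken at most \<open>m\<close> times, so all these bounds are attained.
\<close>

lemma card_power_eq:
  fixes c :: "'k::finite_field"
  assumes md: "m * d = CARD('k) - 1" and pos: "m > 0" "d > 0" and c: "c ^ d = 1"
  shows "card {x. x ^ m = c} = m"
proof -
  define T where "T = {c :: 'k. c ^ d = 1}"
  have T: "card T \<le> d" "c \<in> T"
    using card_power_eq_le(2)[of d 1] pos c by (simp_all add: T_def)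
  have "(x ^ m) ^ d = 1" if "x \<noteq> 0" for x :: 'k
  proof -
    have "x * x ^ (m * d) = x * 1"
      using finite_field_power_card_eq_same[of x] finite_UNIV_card_ge_0[where ?'a = 'k]
      by (simp add: md flip: power_Suc)
    thus ?thesis
      using that by (simp add: power_mult)
  qed
  hence "UNIV - {0} \<subseteq> (\<Union>c\<in>T. {x. x ^ m = c})"
    by (auto simp: T_def)
  hence "card (UNIV - {0 :: 'k}) \<le> card (\<Union>c\<in>T. {x. x ^ m = c})"
    by (intro card_mono) auto
  also have "\<dots> \<le> (\<Sum>c\<in>T. card {x. x ^ m = c})"
    by (intro card_UN_le) auto
  \<comment> \<open>The fibre of \<open>c\<close> is singled out: the other fibres account for at
    most \<open>(d - 1) m\<close> units, which leaves at least \<open>m\<close> for it.\<close>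
  also have "\<dots> = card {x. x ^ m = c} + (\<Sum>c\<in>T - {c}. card {x. x ^ m = c})"
    using T by (intro sum.remove) auto
  also have "(\<Sum>c\<in>T - {c}. card {x. x ^ m = c}) \<le> (\<Sum>c\<in>T - {c}. m)"
    using pos by (intro sum_mono card_power_eq_le)
  also have "\<dots> = (card T - 1) * m"
    using T by simp
  also have "\<dots> \<le> (d - 1) * m"
    using T by (intro mult_right_mono) auto
  finally have "m * d \<le> card {x. x ^ m = c} + (d - 1) * m"
    using md by simp
  moreover have "m * d = (d - 1) * m + m"
    using pos by (cases d) auto
  ultimately show ?thesis
    using card_power_eq_le(2)[of m c] pos by simp
qed

text \<open>Translation by 1 permutes the ring and so preserves the sum of all elements, yet it adds
  1 for each of them.\<close>

lemma of_nat_card_eq_0: "of_nat CARD('a) = (0 :: 'a::{finite,ring_1})"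
proof -
  have "(\<Sum>x\<in>UNIV. x + 1) = (\<Sum>x\<in>UNIV. x :: 'a)"
    by (rule sum.reindex_bij_witness[of _ "\<lambda>x. x - 1" "\<lambda>x. x + 1"]) auto
  thus ?thesis
    by (simp add: sum.distrib)
qed

section \<open>Leading coefficients at the pole of \<open>x\<close>\<close>

definition lead :: "'k::field fls \<Rightarrow> 'k" where
  "lead v = v $$ fls_subdegree v"

lemma lead_eq_0_iff: "lead v = 0 \<longleftrightarrow> v = 0"
  by (simp add: lead_def nth_fls_subdegree_zero_iff)

text \<open>Unlike the constant coefficient, \<open>lead\<close> is multiplicative whatever the
  orders, which suits functions with a pole or zero at infinity.\<close>

lemma lead_mult: "lead (v * w) = lead v * lead w"
  by (cases "v = 0 \<or> w = 0") (auto simp: lead_def)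

lemma lead_divide:
  assumes "w \<noteq> 0"
  shows "lead (v / w) = lead v / lead w"
proof -
  have "lead v = lead (v / w) * lead w"
    using assms by (simp flip: lead_mult)
  thus ?thesis
    using assms by (simp add: lead_eq_0_iff)
qed

text \<open>Up to a power of \<open>t\<close>, the value at \<open>1 / t\<close> is the reversed
  polynomial at \<open>t\<close>, whose constant coefficient is the leading one.\<close>

lemma lead_heval_inverse_X:
  fixes p :: "'k::field poly"
  assumes "p \<noteq> 0"
  shows "lead (FC.heval (inverse fls_X) p) = lead_coeff p"
proof -
  have "fps_of_poly (reflect_poly p) $ 0 \<noteq> 0"
    using assms by simp
  hence "fls_subdegree (FC.heval fls_X (reflect_poly p)) = 0"
    by (simp add: heval_fls_X fls_subdegree_fls_to_fps)
  hence "lead (FC.heval fls_X (reflect_poly p)) = lead_coeff p"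
    by (simp add: lead_def heval_fls_X)
  moreover have "lead (inverse fls_X ^ n :: 'k fls) = 1" for n
    by (simp add: lead_def fls_inverse_X)
  ultimately show ?thesis
    by (simp add: FC.heval_inverse lead_mult)
qed

lemma lead_expand_inf:
  assumes "A \<noteq> 0" "B \<noteq> 0"
  shows "lead (expand_inf (Fract A B)) = lead_coeff A / lead_coeff B"
proof -
  interpret T: transcendental_point fls_const "inverse fls_X :: 'a fls"
    by (rule transcendental_point_fls_X_inverse)
  show ?thesis
    using assms by (simp add: expand_inf_def T.rat_eval_Fract lead_divide T.heval_nonzero lead_heval_inverse_X)
qed

text \<open>The condition \<open>ext_degree \<iota> = m\<close> guards the count and the claims at
  infinity: if \<open>u = w^d\<close> with \<open>d > 1\<close> dividing \<open>m\<close>, then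
  \<open>X^m - u\<close> has the factor \<open>X^(m/d) - w\<close> even though \<open>u\<close> need
  not be an m-th power. The count needs \<open>m\<close> places above each point, and the rescaling
  at infinity needs \<open>m\<close> itself to divide the order of \<open>u\<close>.\<close>

theorem corollary4p7:
  fixes p s q n m :: nat
    and h g :: "'k::finite_field ratfun"
    and \<iota> :: "'k ratfun \<Rightarrow> 'e::field"
    and y :: 'e
  assumes "prime p" and "s > 0" and "q = p ^ s" and "n > 1"
    and "CARD('k) = q ^ n"
    and "m = (q ^ n - 1) div (q - 1)"
    and "is_field_hom \<iota>"
    and "field_adjoin (range \<iota>) y = UNIV"
    and "h \<in> F_qs_phi n q" and "g \<in> F_qs_phi n q"
    and "y ^ m = \<iota> (h / g)"
    and "\<forall>w. h / g \<noteq> w ^ m"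
    and "qs_no_zeros n q h" and "qs_no_zeros n q g"
  shows "(\<forall>P. is_rational_place rf_const P \<and> P \<noteq> P_inf \<longrightarrow> splits_completely rf_const \<iota> P) \<and>
    (ext_degree \<iota> = m \<longrightarrow>
       (\<exists>S. S \<subseteq> {Q. is_rational_place (\<iota> \<circ> rf_const) Q} \<and> finite S \<and>
            card S = (q ^ (2 * n) - q ^ n) div (q - 1)) \<and>
       (gcd (int (ext_degree \<iota>)) (place_val P_inf (h / g)) = int (ext_degree \<iota>) \<longrightarrow>
          splits_completely rf_const \<iota> P_inf \<and>
          (\<forall>P. is_rational_place rf_const P \<longrightarrow> splits_completely rf_const \<iota> P)))"
proof -
  define u where "u = h / g"
  have q2: "q \<ge> 2"
    using assms(1-3) by (metis One_nat_def Suc_1 Suc_leI one_less_power prime_gt_1_nat)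
  have "q ^ 1 \<le> q ^ n"
    using q2 assms(4) by (intro power_increasing) auto
  hence qn: "q ^ n \<ge> 2"
    using q2 by simp
  have md: "m * (q - 1) = q ^ n - 1"
  proof -
    have "int (q - 1) dvd int (q ^ n - 1)"
      using q2 qn power_diff_1_eq[of "int q" n] by (simp add: of_nat_diff)
    hence "q - 1 dvd q ^ n - 1"
      by (simp only: int_dvd_int_iff)
    thus ?thesis
      by (simp add: assms(6))
  qed
  have m_pos: "m > 0"
    using md qn by (cases m) auto
  have "CHAR('k) dvd p ^ (s * n)"
    using of_nat_card_eq_0[where ?'a = 'k] assms(3,5) by (simp only: of_nat_eq_0_iff_char_dvd power_mult)
  hence char: "CHAR('k) = p"
    using assms(1) prime_dvd_power[of "CHAR('k)"] primes_dvd_imp_eq CHAR_prime by blast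
  \<comment> \<open>In K the identity \<open>m (q - 1) = q^n - 1\<close> has right side
    \<open>-1\<close>, so \<open>m\<close> cannot vanish there.\<close>
  have "of_nat (q ^ n) = (0 :: 'k)"
    using of_nat_card_eq_0[where ?'a = 'k] by (simp only: assms(5))
  moreover have "of_nat (q ^ n) = of_nat m * of_nat (q - 1) + (1 :: 'k)"
    using md qn by (metis One_nat_def Suc_1 Suc_leD add.commute le_add_diff_inverse of_nat_1 of_nat_add of_nat_mult)
  ultimately have m_nz: "of_nat m \<noteq> (0 :: 'k)"
    by (metis add_0 mult_zero_left zero_neq_one)
  have md': "m * (q - 1) = CARD('k) - 1"
    by (simp only: md assms(5))
  have unity: "card {\<zeta> :: 'k. \<zeta> ^ m = 1} = m"
    using q2 m_pos by (intro card_power_eq[OF md']) auto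
  \<comment> \<open>Nonzero elements fixed by the q-th power map satisfy \<open>c^(q-1) = 1\<close>,
    so \<open>card_power_eq\<close> with \<open>d = q - 1\<close> provides \<open>m\<close>
    roots.\<close>
  have norm: "\<exists>\<beta>. \<beta> \<noteq> 0 \<and> \<beta> ^ m = c" if "c \<in> Fq q" "c \<noteq> 0" for c :: 'k
  proof -
    have "c * c ^ (q - 1) = c * 1"
      using that q2 by (simp add: Fq_def flip: power_Suc)
    hence "card {x. x ^ m = c} = m"
      using that q2 m_pos by (intro card_power_eq[OF md']) auto
    hence "{x. x ^ m = c} \<noteq> {}"
      using m_pos by (metis card.empty less_irrefl)
    thus ?thesis
      using that m_pos by (auto simp: power_0_left)
  qed
  have Fq_divide: "a / b \<in> Fq q" if "a \<in> Fq q" "b \<in> Fq q" for a b :: 'k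
    using that by (simp add: Fq_def power_divide)
  have \<iota>: "field_embedding \<iota>"
    by unfold_locales (rule assms(7))
  have kummer: "\<exists>\<beta>. kummer_place (expand_at a) rf_const (rf_x - rf_const a) \<iota> y u m \<beta>" for a
  proof -
    note res = qs_residue_in_Fq[OF assms(5) order.strict_trans[OF zero_less_one assms(4)]
        assms(3)[folded char]]
    note rh = res[OF assms(9,13), of a] and rg = res[OF assms(10,14), of a]
    interpret S: series_embedding "expand_at a" rf_const "rf_x - rf_const a"
      by (rule series_embedding_expand_at)
    have u: "expand_at a u = expand_at a h / expand_at a g"
      by (simp add: u_def S.hom_divide)
    have "expand_at a u $$ 0 \<in> Fq q" "expand_at a u $$ 0 \<noteq> 0"
      unfolding u using rh rg by (simp_all add: fls_divide_residue Fq_divide)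
    then obtain \<beta> where "\<beta> \<noteq> 0" "\<beta> ^ m = expand_at a u $$ 0"
      using norm by blast
    moreover have "expand_at a u \<in> fls_ring"
      unfolding u using rh rg by (intro fls_divide_residue)
    moreover interpret field_embedding \<iota>
      by (rule \<iota>)
    have "kummer_place (expand_at a) rf_const (rf_x - rf_const a) \<iota> y u m \<beta>"
      by unfold_locales (use assms calculation m_nz unity in \<open>simp_all add: u_def\<close>)
    thus ?thesis
      by blast
  qed
  have splits_at: "splits_completely rf_const \<iota> (fls_place (expand_at a))" for a
  proof -
    obtain \<beta> where "kummer_place (expand_at a) rf_const (rf_x - rf_const a) \<iota> y u m \<beta>"
      using kummer by blast
    thus ?thesis
      by (rule kummer_place.splits)
  qed
  have finite_places: "splits_completely rf_const \<iota> P"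
    if "is_rational_place rf_const P" "P \<noteq> P_inf" for P
    using that by (elim rational_place_cases) (auto intro: splits_at)
  have count: "\<exists>S. S \<subseteq> {Q. is_rational_place (\<iota> \<circ> rf_const) Q} \<and> finite S \<and>
            card S = (q ^ (2 * n) - q ^ n) div (q - 1)" if deg: "ext_degree \<iota> = m"
  proof -
    define above where "above = (\<lambda>a. {Q. is_place (\<iota> \<circ> rf_const) Q \<and> \<iota> ` fls_place (expand_at a) \<subseteq> Q})"
    define S where "S = (\<Union>a. above a)"
    have above: "finite (above a)" "card (above a) = m" for a
      using splits_at[of a] by (simp_all add: splits_completely_def above_def deg)
    have rational: "is_rational_place (\<iota> \<circ> rf_const) Q" if "Q \<in> above a" for a Q
    proof -
      obtain \<beta> where "kummer_place (expand_at a) rf_const (rf_x - rf_const a) \<iota> y u m \<beta>"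
        using kummer by blast
      thus ?thesis
        using that unfolding above_def by (auto intro: kummer_place.places_above_rational)
    qed
    \<comment> \<open>A common place would contain \<open>x - a\<close> and \<open>x - b\<close>,
      hence the nonzero constant \<open>a - b\<close>.\<close>
    have "above a \<inter> above b = {}" if "a \<noteq> b" for a b
    proof (rule ccontr)
      assume "above a \<inter> above b \<noteq> {}"
      then obtain Q where Q: "is_place (\<iota> \<circ> rf_const) Q" "\<iota> ` fls_place (expand_at a) \<subseteq> Q"
        "\<iota> ` fls_place (expand_at b) \<subseteq> Q"
        by (auto simp: above_def)
      interpret function_place "\<iota> \<circ> rf_const" Q
        by unfold_locales (rule Q)
      interpret field_embedding \<iota>
        by (rule \<iota>)
      have "rf_x - rf_const c \<in> fls_place (expand_at c)" for c :: 'k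
      proof -
        interpret S: series_embedding "expand_at c" rf_const "rf_x - rf_const c"
          by (rule series_embedding_expand_at)
        show ?thesis
          using fls_X_in_ideal by (simp only: fls_place_def mem_Collect_eq S.param)
      qed
      hence "\<iota> (rf_x - rf_const b) \<in> Q" "\<iota> (rf_x - rf_const a) \<in> Q"
        using Q by blast+
      hence "\<iota> (rf_x - rf_const b) - \<iota> (rf_x - rf_const a) \<in> Q"
        by (rule place_diff)
      hence "(\<iota> \<circ> rf_const) (a - b) \<in> Q"
        by (simp add: hom_diff RC.hom_diff)
      thus False
        using const_in_place_iff[OF is_field_hom_compose[OF assms(7) is_field_hom_rf_const]] that by auto
    qed
    hence "card S = (\<Sum>a :: 'k\<in>UNIV. card (above a))"
      unfolding S_def using above by (intro card_UN_disjoint) auto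
    also have "\<dots> = q ^ n * m"
      by (simp add: above assms(5))
    also have "\<dots> = (q ^ n * (m * (q - 1))) div (q - 1)"
      using q2 by simp
    also have "q ^ n * (m * (q - 1)) = q ^ (2 * n) - q ^ n"
      unfolding md by (simp add: diff_mult_distrib2 power_add mult_2)
    finally have "card S = (q ^ (2 * n) - q ^ n) div (q - 1)" .
    moreover have "finite S"
      unfolding S_def using above by auto
    moreover have "S \<subseteq> {Q. is_rational_place (\<iota> \<circ> rf_const) Q}"
      unfolding S_def using rational by blast
    ultimately show ?thesis
      by blast
  qed
  have infinite_place: "splits_completely rf_const \<iota> P_inf"
    if gcd: "gcd (int m) (place_val P_inf u) = int m"
  proof -
    interpret S: series_embedding expand_inf rf_const "inverse rf_x :: 'k ratfun"
      by (rule series_embedding_expand_inf)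
    interpret field_embedding \<iota>
      by (rule \<iota>)
    \<comment> \<open>Zero is an m-th power, so it is excluded; only for nonzero \<open>u\<close> is
      the valuation meaningful.\<close>
    have u0: "u \<noteq> 0"
    proof
      assume "u = 0"
      hence "h / g = 0 ^ m"
        using m_pos by (simp add: u_def power_0_left)
      thus False
        using assms(12) by blast
    qed
    have "int m dvd place_val P_inf u"
      using gcd by (metis gcd_dvd2)
    then obtain k where k: "fls_subdegree (expand_inf u) = int m * k"
      unfolding P_inf_eq S.place_val_fls[OF u0] by (rule dvdE)
    \<comment> \<open>Chosen so that \<open>t ^ m\<close> has the order \<open>m k\<close> of
      \<open>u\<close> and leading coefficient 1: then \<open>u / t ^ m\<close> is a unit whose
      residue is the leading coefficient of \<open>u\<close>.\<close>
    define t :: "'k ratfun" where "t = inverse rf_x powi k"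
    have t0: "t \<noteq> 0"
      by (simp add: t_def rf_x_nonzero)
    have "expand_inf t = fls_X powi k"
      unfolding t_def S.hom_power_int by simp
    hence et: "fls_subdegree (expand_inf t ^ m) = int m * k" "lead (expand_inf t ^ m) = 1"
      by (simp_all add: fls_subdegree_pow lead_def fls_X_intpow_power mult.commute)
    have eu: "expand_inf (u / t ^ m) = expand_inf u / expand_inf t ^ m"
      by (simp add: S.hom_divide S.hom_power)
    have sub0: "fls_subdegree (expand_inf (u / t ^ m)) = 0"
      unfolding eu using u0 t0 by (simp add: fls_divide_subdegree et k)
    have lead: "expand_inf (u / t ^ m) $$ 0 = lead (expand_inf u)"
    proof -
      have "expand_inf (u / t ^ m) $$ 0 = lead (expand_inf (u / t ^ m))"
        by (simp add: lead_def sub0)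
      also have "\<dots> = lead (expand_inf u)"
        unfolding eu using t0 by (subst lead_divide) (simp_all add: et)
      finally show ?thesis .
    qed
    have lead_Fq: "lead (expand_inf w) \<in> Fq q" if w: "w \<in> F_qs_phi n q" "w \<noteq> 0" for w :: "'k ratfun"
    proof -
      obtain A B where AB: "B \<noteq> 0" "w = Fract A B" "\<forall>i. coeff A i \<in> Fq q" "\<forall>i. coeff B i \<in> Fq q"
        using w by (auto simp: F_qs_phi_def)
      have "A \<noteq> 0"
        using AB w by (auto simp: Zero_fract_def eq_fract)
      thus ?thesis
        using AB by (simp add: lead_expand_inf Fq_divide)
    qed
    have hg: "h \<noteq> 0" "g \<noteq> 0"
      using u0 by (auto simp: u_def)
    have "lead (expand_inf u) = lead (expand_inf h) / lead (expand_inf g)"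
      using hg by (simp add: u_def S.hom_divide lead_divide)
    hence "lead (expand_inf u) \<in> Fq q" "lead (expand_inf u) \<noteq> 0"
      using lead_Fq assms(9,10) hg u0 by (simp_all add: Fq_divide lead_eq_0_iff)
    then obtain \<beta> where \<beta>: "\<beta> \<noteq> 0" "\<beta> ^ m = lead (expand_inf u)"
      using norm by blast
    \<comment> \<open>The rescaling factor lies in the base field, so \<open>y / \<iota> t\<close>
      generates the same extension.\<close>
    have adjoin: "field_adjoin (range \<iota>) (y / \<iota> t) = UNIV"
    proof -
      have "y \<in> L" if L: "is_subfield L" "range \<iota> \<subseteq> L" "y / \<iota> t \<in> L" for L
      proof -
        have "(y / \<iota> t) * \<iota> t \<in> L"
          using L by (auto simp: is_subfield_def is_subring_def simp del: times_divide_eq_left)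
        thus ?thesis
          using t0 by simp
      qed
      hence "field_adjoin (range \<iota>) y \<subseteq> field_adjoin (range \<iota>) (y / \<iota> t)"
        unfolding field_adjoin_def by blast
      thus ?thesis
        using assms(8) by blast
    qed
    have "kummer_place expand_inf rf_const (inverse rf_x) \<iota> (y / \<iota> t) (u / t ^ m) m \<beta>"
    proof unfold_locales
      show "(y / \<iota> t) ^ m = \<iota> (u / t ^ m)"
        using assms(11) by (simp only: u_def power_divide hom_divide hom_power)
      show "expand_inf (u / t ^ m) \<in> fls_ring"
        by (simp add: fls_ring_def sub0)
      show "expand_inf (u / t ^ m) $$ 0 = \<beta> ^ m"
        by (simp add: lead \<beta>)
    qed (use adjoin \<beta> m_nz unity in auto)
    thus ?thesis
      unfolding P_inf_eq by (rule kummer_place.splits)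
  qed
  show ?thesis
    using finite_places count infinite_place by (auto simp: u_def)
qed

end
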